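(* Let $p$ be an odd prime, $r$ a positive integer, and $m\neq 1$ a square-free rational integer not divisible by $p$, such that $F(x)=x^{p^r}-m$ is irreducible over $\mathbb{Q}$. Let $\alpha$ be a complex root of $F(x)$ and $K=\mathbb{Q}(\alpha)$. If $\nu_p(m^{p-1}-1)>p$ and $r\ge p$, then $K$ is not monogenic.
   Context: $\nu_p$ denotes the $p$-adic valuation. $K$ is called monogenic if its ring of integers $\mathbb{Z}_K$ equals $\mathbb{Z}[\theta]$ for some $\theta\in\mathbb{Z}_K$. *)

theory Defs
  imports "HOL-Computational_Algebra.Computational_Algebra" "HOL-Computational_Algebra.Squarefree"
begin

definition is_subfield_complex :: "complex set \<Rightarrow> bool" where
  "is_subfield_complex S \<longleftrightarrow> 0 \<in> S \<and> 1 \<in> S \<and>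
     (\<forall>x\<in>S. \<forall>y\<in>S. x + y \<in> S \<and> x - y \<in> S \<and> x * y \<in> S) \<and>
     (\<forall>x\<in>S. x \<noteq> 0 \<longrightarrow> inverse x \<in> S)"

definition simple_ext :: "complex \<Rightarrow> complex set" where
  "simple_ext \<alpha> = \<Inter>{S. is_subfield_complex S \<and> \<alpha> \<in> S}"

definition ring_of_integers :: "complex set \<Rightarrow> complex set" where
  "ring_of_integers K = {x \<in> K. algebraic_int x}"

definition int_adjoin :: "complex \<Rightarrow> complex set" where
  "int_adjoin \<theta> = {poly (map_poly of_int f) \<theta> | f :: int poly. True}"

definition monogenic :: "complex set \<Rightarrow> bool" where
  "monogenic K \<longleftrightarrow> (\<exists>\<theta> \<in> ring_of_integers K. ring_of_integers K = int_adjoin \<theta>)"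

end

theory Submission
  imports "Jordan_Normal_Form.Char_Poly" "HOL-Computational_Algebra.Field_as_Ring" Defs
begin

text \<open>
  The ring of integers \<open>O\<close> has more than \<open>p\<close> ring homomorphisms onto \<open>\<int>/p\<close>, while a quotient of
  \<open>\<int>[x]\<close> has at most \<open>p\<close>. Let \<open>s\<close> be the minimum of \<open>r\<close> and \<open>\<nu>\<^sub>p(m\<^bsup>p-1\<^esup> - 1) - 1\<close>, so that \<open>s \<ge> p\<close>, and put
  \<open>t = r - s\<close>. By Hensel lifting, \<open>m\<close> is \<open>p\<close>-adically close to the inverse of a \<open>p\<^sup>s\<close>-th power of an
  integer \<open>a\<close>, and \<open>z = a \<alpha>\<^sup>q\<close> with \<open>q = p\<^sup>t\<close> satisfies \<open>z\<^sup>k \<approx> 1\<close> with \<open>k = p\<^sup>s\<close>. The idempotents of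
  the group algebra of a cyclic group of order \<open>p\<^sup>s\<close>, evaluated at \<open>z\<close>, satisfy monic quadratic equations,
  hence are integral, and they split \<open>O\<close> modulo \<open>p\<close> into \<open>s + 1\<close> nonzero blocks. On the \<open>j\<close>-th block \<open>z\<close>
  is annihilated by the cyclotomic polynomial of order \<open>p\<^sup>j\<close>. As a polynomial in \<open>\<pi> = \<alpha> - m\<close> this is
  Eisenstein up to a unit, of some degree \<open>d\<^sub>j\<close>, so \<open>1, \<pi>, \<pi>\<^sup>2, \<dots>\<close> give \<open>d\<^sub>j\<close> independent elements in the
  block. As the \<open>d\<^sub>j\<close> add up to the degree of the field, every block is totally ramified with residue
  field \<open>\<int>/p\<close>.
\<close>

section \<open>Integral elements and integer polynomials\<close>

abbreviation ipoly :: "int poly \<Rightarrow> complex \<Rightarrow> complex" where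
  "ipoly f x \<equiv> poly (map_poly of_int f) x"

text \<open>The vector \<open>v\<close> is a nonzero eigenvector, for the eigenvalue
  \<open>x\<close>, of an integer matrix. The exact degree \<open>N\<close> later bounds how many
  powers of \<theta> span the ring modulo \<open>p\<close>.\<close>

lemma int_module_char_poly:
  fixes x :: complex and v :: "nat \<Rightarrow> complex"
  assumes stable: "\<And>i. i < N \<Longrightarrow> \<exists>c :: nat \<Rightarrow> int. x * v i = (\<Sum>j<N. of_int (c j) * v j)"
    and nz: "i0 < N" "v i0 \<noteq> 0"
  shows "\<exists>f :: int poly. lead_coeff f = 1 \<and> degree f = N \<and> ipoly f x = 0"
proof -
  obtain c :: "nat \<Rightarrow> nat \<Rightarrow> int" where c: "\<And>i. i < N \<Longrightarrow> x * v i = (\<Sum>j<N. of_int (c i j) * v j)"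
    using stable by metis
  define A where "A = mat N N (\<lambda>(i, j). c i j)"
  have A: "A \<in> carrier_mat N N" by (simp add: A_def)
  define B :: "complex mat" where "B = map_mat of_int A"
  have B: "B \<in> carrier_mat N N" using A by (simp add: B_def)
  have "eigenvector B (vec N v) x"
    unfolding eigenvector_def
  proof (intro conjI)
    show "vec N v \<in> carrier_vec (dim_row B)" using B by auto
    show "vec N v \<noteq> 0\<^sub>v (dim_row B)"
    proof
      assume "vec N v = 0\<^sub>v (dim_row B)"
      then have "vec_index (vec N v) i0 = 0" using nz B by simp
      then show False using nz by simp
    qed
    show "B *\<^sub>v vec N v = x \<cdot>\<^sub>v vec N v"
      using B by (intro eq_vecI) (auto simp: scalar_prod_def B_def A_def c lessThan_atLeast0)
  qed
  then have "poly (char_poly B) x = 0"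
    using eigenvalue_root_char_poly[OF B] by (auto simp: eigenvalue_def)
  then have "ipoly (char_poly A) x = 0"
    unfolding B_def by (subst (asm) of_int_hom.char_poly_hom[OF A]) simp
  then show ?thesis
    using degree_monic_char_poly[OF A] by metis
qed

lemma ipoly_simps [simp]:
  "ipoly 0 x = 0" "ipoly 1 x = 1"
  "ipoly (f + g) x = ipoly f x + ipoly g x"
  "ipoly (f - g) x = ipoly f x - ipoly g x"
  "ipoly (- f) x = - ipoly f x"
  "ipoly (f * g) x = ipoly f x * ipoly g x"
  "ipoly (f ^ n) x = ipoly f x ^ n"
  "ipoly (Polynomial.smult c f) x = of_int c * ipoly f x"
  "ipoly (pCons c f) x = of_int c + x * ipoly f x"
  "ipoly (monom c n) x = of_int c * x ^ n"
  "ipoly (of_int c) x = of_int c"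
  by (simp_all add: hom_distribs poly_monom of_int_poly of_int_hom.map_poly_hom_monom)

lemma ipoly_sum: "ipoly (\<Sum>i\<in>A. f i) x = (\<Sum>i\<in>A. ipoly (f i) x)"
  by (induction A rule: infinite_finite_induct) auto

lemma ipoly_eq_sum:
  assumes "\<forall>i\<ge>n. coeff v i = 0"
  shows "ipoly v x = (\<Sum>i<n. of_int (coeff v i) * x ^ i)"
proof -
  have "v = (\<Sum>i<n. monom (coeff v i) i)"
    using assms by (intro poly_eqI) (auto simp: coeff_sum)
  then have "ipoly v x = ipoly (\<Sum>i<n. monom (coeff v i) i) x" by (rule arg_cong)
  then show ?thesis by (simp add: ipoly_sum poly_monom)
qed

lemma degree_monom_diff_const:
  fixes c :: "'a :: comm_ring_1"
  assumes "n > 0"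
  shows "degree (monom 1 n - [:c:]) = n" "lead_coeff (monom 1 n - [:c:]) = 1"
proof -
  have n: "coeff (monom 1 n - [:c:]) n = 1"
    using assms by (auto simp: coeff_pCons split: nat.splits)
  show deg: "degree (monom 1 n - [:c:]) = n"
    using n by (intro antisym degree_diff_le le_degree) (auto simp: degree_monom_le)
  show "lead_coeff (monom 1 n - [:c:]) = 1" unfolding deg by (fact n)
qed

text \<open>Pseudo-division scales \<open>f\<close> only by a power of the leading coefficient.
  Bounding coefficients of the remainder also covers constant \<open>g\<close>, where
  \<open>v\<close> must be 0.\<close>

lemma monic_int_poly_division:
  fixes f g :: "int poly"
  assumes "lead_coeff g = 1"
  shows "\<exists>u v. f = g * u + v \<and> (\<forall>i\<ge>degree g. coeff v i = 0)"
proof -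
  have g: "g \<noteq> 0" using assms by auto
  obtain q where eq: "pseudo_divmod f g = (q, pseudo_mod f g)"
    by (metis prod.collapse pseudo_mod_def)
  have "Polynomial.smult (lead_coeff g ^ (Suc (degree f) - degree g)) f = g * q + pseudo_mod f g"
    using pseudo_divmod(1)[OF g eq] .
  moreover have "\<forall>i\<ge>degree g. coeff (pseudo_mod f g) i = 0"
    using pseudo_mod(2)[OF g, of f] coeff_eq_0 by fastforce
  ultimately show ?thesis using assms by auto
qed

section \<open>Congruences modulo integers in a subring of the complex numbers\<close>

locale complex_subring =
  fixes R :: "complex set"
  assumes of_int_mem [simp, intro]: "of_int k \<in> R"
    and add_mem [intro]: "x \<in> R \<Longrightarrow> y \<in> R \<Longrightarrow> x + y \<in> R"
    and mult_mem [intro]: "x \<in> R \<Longrightarrow> y \<in> R \<Longrightarrow> x * y \<in> R"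
begin

text \<open>Only the quotient \<open>w\<close> must lie in \<open>R\<close>, so multiplication rules
  need membership hypotheses.\<close>

definition rcong :: "int \<Rightarrow> complex \<Rightarrow> complex \<Rightarrow> bool" where
  "rcong q x y \<longleftrightarrow> (\<exists>w\<in>R. x - y = of_int q * w)"

lemma zero_mem [simp, intro]: "0 \<in> R" and one_mem [simp, intro]: "1 \<in> R"
  using of_int_mem[of 0] of_int_mem[of 1] by simp_all

lemma uminus_mem [intro]: "x \<in> R \<Longrightarrow> - x \<in> R"
  using mult_mem[of "of_int (-1)" x] of_int_mem[of "-1"] by simp

lemma diff_mem [intro]: "x \<in> R \<Longrightarrow> y \<in> R \<Longrightarrow> x - y \<in> R"
  using add_mem[of x "- y"] uminus_mem[of y] by simp

lemma power_mem [intro]: "x \<in> R \<Longrightarrow> x ^ n \<in> R"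
  by (induction n) auto

lemma sum_mem [intro]: "(\<And>i. i \<in> A \<Longrightarrow> f i \<in> R) \<Longrightarrow> sum f A \<in> R"
  by (induction A rule: infinite_finite_induct) auto

lemma ipoly_mem [intro]: "x \<in> R \<Longrightarrow> ipoly f x \<in> R"
  by (induction f) auto

lemma rcong_refl [simp, intro]: "rcong q x x"
  unfolding rcong_def by (intro bexI[of _ 0]) auto

lemma rcong_sym: "rcong q x y \<Longrightarrow> rcong q y x"
  unfolding rcong_def by (metis minus_diff_eq mult_minus_right uminus_mem)

lemma rcong_trans [trans]: "rcong q x y \<Longrightarrow> rcong q y z \<Longrightarrow> rcong q x z"
  unfolding rcong_def
proof (elim bexE)
  fix w w' assume "w \<in> R" "w' \<in> R" "x - y = of_int q * w" "y - z = of_int q * w'"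
  then show "\<exists>w\<in>R. x - z = of_int q * w"
    by (intro bexI[of _ "w + w'"]) (auto simp: algebra_simps)
qed

lemma rcong_add: "rcong q x y \<Longrightarrow> rcong q x' y' \<Longrightarrow> rcong q (x + x') (y + y')"
  unfolding rcong_def
proof (elim bexE)
  fix w w' assume "w \<in> R" "w' \<in> R" "x - y = of_int q * w" "x' - y' = of_int q * w'"
  then show "\<exists>w\<in>R. x + x' - (y + y') = of_int q * w"
    by (intro bexI[of _ "w + w'"]) (auto simp: algebra_simps)
qed

lemma rcong_mult_left: "rcong q x y \<Longrightarrow> z \<in> R \<Longrightarrow> rcong q (z * x) (z * y)"
  unfolding rcong_def
proof (elim bexE)
  fix w assume "w \<in> R" "x - y = of_int q * w" "z \<in> R"
  then show "\<exists>w\<in>R. z * x - z * y = of_int q * w"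
    by (intro bexI[of _ "z * w"]) (auto simp: algebra_simps)
qed

lemma rcong_diff: "rcong q x y \<Longrightarrow> rcong q x' y' \<Longrightarrow> rcong q (x - x') (y - y')"
  using rcong_add[of q x y "- x'" "- y'"] rcong_mult_left[of q x' y' "-1"]
  by (simp add: uminus_mem)

lemma rcong_mult:
  assumes "rcong q x y" "rcong q x' y'" "x \<in> R" "y' \<in> R"
  shows "rcong q (x * x') (y * y')"
  using rcong_trans[OF rcong_mult_left[OF assms(2,3)]] rcong_mult_left[OF assms(1,4)]
  by (simp add: mult.commute)

lemma rcong_sum: "(\<And>i. i \<in> A \<Longrightarrow> rcong q (f i) (g i)) \<Longrightarrow> rcong q (sum f A) (sum g A)"
  by (induction A rule: infinite_finite_induct) (auto intro: rcong_add)

lemma rcong_power: "rcong q x y \<Longrightarrow> x \<in> R \<Longrightarrow> y \<in> R \<Longrightarrow> rcong q (x ^ n) (y ^ n)"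
  by (induction n) (auto intro!: rcong_mult)

lemma rcong_dvd: "q dvd a - b \<Longrightarrow> rcong q (of_int a) (of_int b)"
  unfolding rcong_def dvd_def by (metis of_int_diff of_int_mem of_int_mult)

lemma rcong_dvd_mult: "q dvd a - b \<Longrightarrow> x \<in> R \<Longrightarrow> rcong q (of_int a * x) (of_int b * x)"
  by (metis mult.commute rcong_dvd rcong_mult_left)

lemma rcong_0_dvd: "q dvd a \<Longrightarrow> x \<in> R \<Longrightarrow> rcong q (of_int a * x) 0"
  using rcong_dvd_mult[of q a 0 x] by simp

lemma rcong_modulus_dvd: "rcong q x y \<Longrightarrow> q' dvd q \<Longrightarrow> rcong q' x y"
  unfolding rcong_def dvd_def by (metis mult.assoc mult_mem of_int_mem of_int_mult)

lemma rcong_cancel: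
  assumes "coprime q a" "rcong q (of_int a * x) 0" "x \<in> R"
  shows "rcong q x 0"
proof -
  obtain u v where uv: "u * q + v * a = 1"
    using assms(1) bezout_int[of q a] by (auto simp: coprime_iff_gcd_eq_1)
  have "rcong q (of_int v * (of_int a * x)) (of_int v * 0)"
    using assms(2) by (rule rcong_mult_left) auto
  moreover have "rcong q (of_int (v * a) * x) (of_int 1 * x)"
  proof (rule rcong_dvd_mult)
    have "v * a - 1 = q * (- u)" using uv by (simp add: algebra_simps)
    then show "q dvd v * a - 1" by simp
  qed (use assms in auto)
  ultimately show ?thesis
    by (metis mult.assoc mult_1 mult_zero_right of_int_1 of_int_mult rcong_sym rcong_trans)
qed

text \<open>Only a polynomial that is nonzero modulo \<open>p\<close> is needed: its reduction has an invertible
  leading coefficient, so Gauss's lemma is avoided.\<close>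

lemma power_span_mod_prime:
  assumes R: "R = int_adjoin \<theta>" and p: "prime p"
    and q: "degree q \<le> n" "ipoly q \<theta> = 0" "\<not> int p dvd coeff q k" and x: "x \<in> R"
  shows "\<exists>b \<in> {..<n} \<rightarrow>\<^sub>E {0..<int p}. rcong (int p) x (\<Sum>i<n. of_int (b i) * \<theta> ^ i)"
proof -
  have pp: "prime (int p)" using p by simp
  have \<theta>: "\<theta> \<in> R"
    unfolding R int_adjoin_def by (intro CollectI exI[of _ "[:0, 1:]"]) simp
  define k' where "k' = Max {k. \<not> int p dvd coeff q k}"
  have fin: "finite {k. \<not> int p dvd coeff q k}"
    by (rule finite_subset[of _ "{..degree q}"]) (auto intro: le_degree)
  have k': "\<not> int p dvd coeff q k'"
    using Max_in[OF fin] q(3) by (auto simp: k'_def)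
  have above: "int p dvd coeff q i" if "i > k'" for i
    using Max_ge[OF fin, of i] that by (auto simp: k'_def)
  have "k' \<le> n"
    using k' q(1) by (metis dvd_0_right le_degree le_trans)
  obtain c d where cd: "c * coeff q k' + d * int p = 1"
    using prime_imp_coprime[OF pp k'] bezout_int[of "int p" "coeff q k'"]
    by (auto simp: coprime_iff_gcd_eq_1 add.commute)
  \<comment> \<open>\<open>k'\<close> is the degree of \<open>q\<close> modulo \<open>p\<close>, and
    \<open>c\<close> inverts the coefficient there. So \<open>g\<close> is monic over the integers,
    which allows exact division, and is congruent to \<open>c\<close> times
    \<open>q\<close>.\<close>
  define g where "g = monom 1 k' + (\<Sum>i<k'. monom (c * coeff q i) i)"
  have coeff_g: "coeff g i = (if i = k' then 1 else if i < k' then c * coeff q i else 0)" for i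
    by (auto simp: g_def coeff_sum)
  have deg_g: "degree g = k'"
    by (intro antisym degree_le le_degree) (auto simp: coeff_g)
  have "rcong (int p) (ipoly g \<theta>) (ipoly (Polynomial.smult c q) \<theta>)"
  proof -
    have "int p dvd coeff g i - c * coeff q i" for i
    proof (cases i k' rule: linorder_cases)
      case equal
      have "1 - c * coeff q k' = int p * d" using cd by (simp add: algebra_simps)
      then show ?thesis using equal by (simp add: coeff_g)
    qed (use above in \<open>auto simp: coeff_g\<close>)
    then have "[:int p:] dvd g - Polynomial.smult c q"
      unfolding const_poly_dvd_iff by simp
    then obtain h where h: "g - Polynomial.smult c q = [:int p:] * h" by (elim dvdE)
    have "ipoly g \<theta> - ipoly (Polynomial.smult c q) \<theta> = ipoly (g - Polynomial.smult c q) \<theta>"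
      by (simp only: ipoly_simps)
    also have "\<dots> = of_int (int p) * ipoly h \<theta>"
      unfolding h by simp
    finally have "ipoly g \<theta> - ipoly (Polynomial.smult c q) \<theta> = of_int (int p) * ipoly h \<theta>" .
    then show ?thesis unfolding rcong_def using \<theta> by blast
  qed
  then have g0: "rcong (int p) (ipoly g \<theta>) 0" using q(2) by simp
  obtain f where f: "x = ipoly f \<theta>" using x unfolding R int_adjoin_def by auto
  obtain u v where uv: "f = g * u + v" "\<forall>i\<ge>k'. coeff v i = 0"
    using monic_int_poly_division[of g f] by (auto simp: deg_g coeff_g)
  define b where "b = (\<lambda>i\<in>{..<n}. coeff v i mod int p)"
  have "rcong (int p) (ipoly g \<theta> * ipoly u \<theta> + ipoly v \<theta>) (0 * ipoly u \<theta> + ipoly v \<theta>)"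
    using \<theta> by (intro rcong_add rcong_mult g0) auto
  then have "rcong (int p) x (ipoly v \<theta>)" by (simp add: f uv(1))
  also have "ipoly v \<theta> = (\<Sum>i<n. of_int (coeff v i) * \<theta> ^ i)"
    using uv(2) \<open>k' \<le> n\<close> by (intro ipoly_eq_sum) auto
  also have "rcong (int p) \<dots> (\<Sum>i<n. of_int (b i) * \<theta> ^ i)"
    using \<theta> by (intro rcong_sum rcong_dvd_mult) (auto simp: b_def mod_eq_dvd_iff[symmetric])
  finally show ?thesis
    using p by (intro bexI[of _ b]) (auto simp: b_def prime_gt_0_nat)
qed

end

section \<open>Counting orthogonal idempotents modulo a prime\<close>

context complex_subring
begin

text \<open>The products \<open>e\<^sub>j \<pi>\<^sup>i\<close> are linearly independent modulo \<open>p\<close> and as numerous as the powers of \<open>\<theta>\<close>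
  that span, so they form a basis. Hence \<open>\<theta>\<close> acts on the socle of the \<open>j\<close>-th block as a scalar in
  \<open>\<int>/p\<close>, and two blocks with the same scalar cannot be separated by a polynomial in \<open>\<theta>\<close>.\<close>

lemma idempotent_blocks_bound:
  assumes R: "R = int_adjoin \<theta>" and p: "prime p"
    and q: "degree q \<le> n" "ipoly q \<theta> = 0" "\<not> int p dvd coeff q k0"
    and dims: "(\<Sum>j\<le>s. d j) = n" "\<And>j. j \<le> s \<Longrightarrow> d j > 0"
    and mem: "\<And>j. j \<le> s \<Longrightarrow> e j \<in> R" "\<pi> \<in> R"
    and idem: "\<And>j. j \<le> s \<Longrightarrow> rcong p (e j * e j) (e j)"
    and orth: "\<And>j k. j \<le> s \<Longrightarrow> k \<le> s \<Longrightarrow> j \<noteq> k \<Longrightarrow> rcong p (e j * e k) 0"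
    and nil: "\<And>j. j \<le> s \<Longrightarrow> rcong p (e j * \<pi> ^ d j) 0"
    and socle: "\<And>j. j \<le> s \<Longrightarrow> \<not> rcong p (e j * \<pi> ^ (d j - 1)) 0"
  shows "s < p"
proof (rule ccontr)
  assume "\<not> s < p"
  have pp: "prime (int p)" using p by simp
  have \<theta>: "\<theta> \<in> R"
    unfolding R int_adjoin_def by (intro CollectI exI[of _ "[:0, 1:]"]) simp
  define \<mu> where "\<mu> j = e j * \<pi> ^ (d j - 1)" for j
  have \<mu>: "\<mu> j \<in> R" if "j \<le> s" for j using mem that by (auto simp: \<mu>_def)
  have \<mu>0: "int p dvd a" if "rcong p (of_int a * \<mu> j) 0" "j \<le> s" for a j
    using rcong_cancel[of "int p" a "\<mu> j"] prime_imp_coprime[OF pp, of a] socle[of j] \<mu>[of j] that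
    by (auto simp: \<mu>_def)
  define U where "U c = (\<Sum>j\<le>s. \<Sum>i<d j. of_int (c (j, i)) * (e j * \<pi> ^ i))"
    for c :: "nat \<times> nat \<Rightarrow> int"
  have proj: "rcong p (e k * U c) (\<Sum>i<d k. of_int (c (k, i)) * (e k * \<pi> ^ i))"
    if k: "k \<le> s" for k c
  proof -
    have "e k * U c = (\<Sum>j\<le>s. \<Sum>i<d j. of_int (c (j, i)) * (e k * e j * \<pi> ^ i))"
      by (simp add: U_def sum_distrib_left algebra_simps)
    also have "rcong p \<dots> (\<Sum>j\<le>s. \<Sum>i<d j. of_int (c (j, i)) * ((if j = k then e k else 0) * \<pi> ^ i))"
    proof (intro rcong_sum rcong_mult_left[OF rcong_mult])
      fix j assume "j \<in> {..s}"
      then show "rcong p (e k * e j) (if j = k then e k else 0)"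
        using idem[of k] orth[of k j] k by auto
    qed (use mem k in auto)
    also have "\<dots> = (\<Sum>j\<le>s. if j = k then \<Sum>i<d k. of_int (c (k, i)) * (e k * \<pi> ^ i) else 0)"
      by (intro sum.cong) auto
    also have "\<dots> = (\<Sum>i<d k. of_int (c (k, i)) * (e k * \<pi> ^ i))"
      using k by simp
    finally show ?thesis .
  qed
  \<comment> \<open>This power of \<open>\<pi>\<close> pushes the terms above \<open>l\<close> past
    the nilpotency exponent, and \<open>low\<close> kills those below \<open>l\<close>; only
    coefficient \<open>l\<close> survives, on the socle element \<open>\<mu> k\<close>.\<close>
  have top: "rcong p (\<pi> ^ (d k - 1 - l) * (e k * U c)) (of_int (c (k, l)) * \<mu> k)"
    if k: "k \<le> s" and l: "l < d k" and low: "\<And>i. i < l \<Longrightarrow> int p dvd c (k, i)" for k l c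
  proof -
    have "rcong p (\<pi> ^ (d k - 1 - l) * (e k * U c))
            (\<pi> ^ (d k - 1 - l) * (\<Sum>i<d k. of_int (c (k, i)) * (e k * \<pi> ^ i)))"
      using proj[OF k] mem by (intro rcong_mult_left) auto
    also have "\<dots> = (\<Sum>i<d k. of_int (c (k, i)) * (e k * \<pi> ^ (d k - 1 - l + i)))"
      by (simp add: sum_distrib_left power_add algebra_simps)
    also have "rcong p \<dots> (\<Sum>i<d k. if i = l then of_int (c (k, l)) * \<mu> k else 0)"
    proof (rule rcong_sum)
      fix i assume "i \<in> {..<d k}"
      consider "i < l" | "i = l" | "i > l" by linarith
      then show "rcong p (of_int (c (k, i)) * (e k * \<pi> ^ (d k - 1 - l + i)))
                   (if i = l then of_int (c (k, l)) * \<mu> k else 0)"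
      proof cases
        case 1
        then show ?thesis using low[of i] mem k by (auto intro!: rcong_0_dvd)
      next
        case 2
        then show ?thesis using l by (simp add: \<mu>_def)
      next
        case 3
        then have "d k - 1 - l + i = d k + (i - l - 1)" using l by simp
        then have "of_int (c (k, i)) * (e k * \<pi> ^ (d k - 1 - l + i))
            = of_int (c (k, i)) * \<pi> ^ (i - l - 1) * (e k * \<pi> ^ d k)"
          by (simp add: power_add)
        moreover have "rcong p \<dots> (of_int (c (k, i)) * \<pi> ^ (i - l - 1) * 0)"
          using mem by (intro rcong_mult_left nil k) auto
        ultimately have "rcong p (of_int (c (k, i)) * (e k * \<pi> ^ (d k - 1 - l + i))) 0"
          by (simp only: mult_zero_right)
        with 3 show ?thesis by simp
      qed
    qed
    also have "\<dots> = of_int (c (k, l)) * \<mu> k" using l by simp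
    finally show ?thesis .
  qed
  have indep: "int p dvd c (k, l)" if U0: "rcong p (U c) 0" and k: "k \<le> s" and l: "l < d k" for c k l
    using l
  proof (induction l rule: less_induct)
    case (less l)
    have "rcong p (of_int (c (k, l)) * \<mu> k) (\<pi> ^ (d k - 1 - l) * (e k * U c))"
      by (intro rcong_sym[OF top] k less) (use less in auto)
    also have "rcong p \<dots> (\<pi> ^ (d k - 1 - l) * (e k * 0))"
      using mem k by (intro rcong_mult_left U0) auto
    finally show ?case using \<mu>0 k by simp
  qed
  define I where "I = Sigma {..s} (\<lambda>j. {..<d j})"
  define C where "C = I \<rightarrow>\<^sub>E {0..<int p}"
  define B where "B = {..<n} \<rightarrow>\<^sub>E {0..<int p}"
  define T where "T b = (\<Sum>i<n. of_int (b i) * \<theta> ^ i)" for b :: "nat \<Rightarrow> int"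
  have span: "\<exists>b\<in>B. rcong p x (T b)" if "x \<in> R" for x
    using power_span_mod_prime[OF R p q that] by (simp add: B_def T_def)
  have U_mem: "U c \<in> R" for c unfolding U_def using mem by (intro sum_mem mult_mem) auto
  \<comment> \<open>\<open>indep\<close> will make \<open>F\<close> injective on \<open>C\<close>;
    as \<open>C\<close> and \<open>B\<close> have equal size, it is onto \<open>B\<close>, so
    \<theta> itself is congruent to some \<open>U c\<close>.\<close>
  obtain F where F: "\<And>c. F c \<in> B" "\<And>c. rcong p (U c) (T (F c))"
    using span[OF U_mem] by metis
  have "inj_on F C"
  proof (rule inj_onI)
    fix c c' assume c: "c \<in> C" "c' \<in> C" "F c = F c'"
    have "rcong p (U c - U c') (T (F c) - T (F c'))" by (intro rcong_diff F)
    then have *: "rcong p (U (\<lambda>x. c x - c' x)) 0"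
      using c(3) by (simp add: U_def sum_subtractf algebra_simps)
    show "c = c'"
    proof (rule PiE_ext)
      show "c \<in> I \<rightarrow>\<^sub>E {0..<int p}" "c' \<in> I \<rightarrow>\<^sub>E {0..<int p}" using c by (auto simp: C_def)
      fix x assume x: "x \<in> I"
      then have "int p dvd c x - c' x" using indep[OF *] by (auto simp: I_def)
      moreover have "c x \<in> {0..<int p}" "c' x \<in> {0..<int p}"
        using c x unfolding C_def by (meson PiE_mem)+
      ultimately show "c x = c' x" by (metis atLeastLessThan_iff mod_eq_dvd_iff mod_pos_pos_trivial)
    qed
  qed
  moreover have "finite B" by (auto simp: B_def intro!: finite_PiE)
  moreover have "card C = card B"
    by (simp add: C_def B_def I_def card_PiE dims)
  ultimately have "F ` C = B"
    by (intro card_subset_eq) (use F in \<open>auto simp: card_image\<close>)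
  obtain b where "b \<in> B" "rcong p \<theta> (T b)" using span[OF \<theta>] by auto
  then obtain c where "c \<in> C" and "rcong p \<theta> (T (F c))" using \<open>F ` C = B\<close> by auto
  then have \<theta>U: "rcong p \<theta> (U c)" using F(2)[of c] rcong_sym rcong_trans by blast
  have eigen: "rcong p (\<mu> k * \<theta>) (of_int (c (k, 0)) * \<mu> k)" if k: "k \<le> s" for k
  proof -
    have "rcong p (\<mu> k * \<theta>) (\<mu> k * U c)" using \<mu>[OF k] by (intro rcong_mult_left \<theta>U)
    also have "\<mu> k * U c = \<pi> ^ (d k - 1 - 0) * (e k * U c)" by (simp add: \<mu>_def)
    also have "rcong p \<dots> (of_int (c (k, 0)) * \<mu> k)"
      using dims k by (intro top) auto
    finally show ?thesis .
  qed
  have eigen_poly: "rcong p (\<mu> k * ipoly h \<theta>) (of_int (poly h (c (k, 0))) * \<mu> k)"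
    if k: "k \<le> s" for k h
  proof (induction h)
    case (pCons a h)
    have "\<mu> k * ipoly (pCons a h) \<theta> = of_int a * \<mu> k + \<theta> * (\<mu> k * ipoly h \<theta>)"
      by (simp add: algebra_simps)
    also have "rcong p \<dots> (of_int a * \<mu> k + \<theta> * (of_int (poly h (c (k, 0))) * \<mu> k))"
      using \<theta> by (intro rcong_add rcong_refl rcong_mult_left pCons)
    also have "\<dots> = of_int a * \<mu> k + of_int (poly h (c (k, 0))) * (\<mu> k * \<theta>)"
      by simp
    also have "rcong p \<dots> (of_int a * \<mu> k + of_int (poly h (c (k, 0))) * (of_int (c (k, 0)) * \<mu> k))"
      using k by (intro rcong_add rcong_refl rcong_mult_left eigen) auto
    finally show ?case by (simp add: algebra_simps)
  qed simp
  \<comment> \<open>Pigeonhole: \<open>s + 1\<close> scalars lie among \<open>p\<close>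
    residues.\<close>
  have "\<not> inj_on (\<lambda>j. c (j, 0)) {..s}"
  proof
    assume "inj_on (\<lambda>j. c (j, 0)) {..s}"
    moreover have "(\<lambda>j. c (j, 0)) ` {..s} \<subseteq> {0..<int p}"
      using \<open>c \<in> C\<close> dims by (auto simp: C_def I_def PiE_def Pi_def)
    ultimately have "card {..s} \<le> card {0..<int p}" by (intro card_inj_on_le) auto
    then show False using \<open>\<not> s < p\<close> by simp
  qed
  then obtain i k where ik: "i \<le> s" "k \<le> s" "i \<noteq> k" and cc: "c (i, 0) = c (k, 0)"
    by (auto simp: inj_on_def)
  \<comment> \<open>At the common scalar, \<open>h\<close> is 0 modulo \<open>p\<close> because
    \<open>e i\<close> kills block \<open>k\<close>; but \<open>e i\<close> is the identity on block
    \<open>i\<close>, so \<open>\<mu> i\<close> would vanish.\<close>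
  obtain h where h: "e i = ipoly h \<theta>" using mem(1)[OF ik(1)] unfolding R int_adjoin_def by auto
  have "\<mu> k * e i = \<pi> ^ (d k - 1) * (e k * e i)" by (simp add: \<mu>_def)
  moreover have "rcong p \<dots> (\<pi> ^ (d k - 1) * 0)"
    using ik mem by (intro rcong_mult_left orth) auto
  ultimately have "rcong p (of_int (poly h (c (k, 0))) * \<mu> k) 0"
    using eigen_poly[OF ik(2), of h] h by (metis mult_zero_right rcong_sym rcong_trans)
  then have dvd: "int p dvd poly h (c (k, 0))" using \<mu>0 ik by blast
  have "rcong p (\<pi> ^ (d i - 1) * e i) (\<pi> ^ (d i - 1) * (e i * e i))"
    using ik mem by (intro rcong_mult_left rcong_sym[OF idem]) auto
  also have "\<pi> ^ (d i - 1) * (e i * e i) = \<mu> i * ipoly h \<theta>" by (simp add: \<mu>_def h)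
  also have "rcong p \<dots> (of_int (poly h (c (i, 0))) * \<mu> i)" by (intro eigen_poly ik)
  also have "rcong p \<dots> 0" using dvd cc \<mu>[OF ik(1)] by (intro rcong_0_dvd) auto
  finally show False using socle[OF ik(1)] by (simp add: mult.commute)
qed

end

section \<open>Congruences modulo prime powers\<close>

lemma dvd_diff_trans: "q dvd x - y \<Longrightarrow> q dvd y - z \<Longrightarrow> q dvd x - (z :: 'a :: comm_ring_1)"
  using dvd_add[of q "x - y" "y - z"] by simp

lemma dvd_diff_power: "q dvd x - y \<Longrightarrow> q dvd x ^ n - (y :: 'a :: comm_ring_1) ^ n"
  unfolding power_diff_sumr2 by (rule dvd_mult2)

text \<open>In the binomial expansion the terms with \<open>2 <= k < p\<close> gain a factor
  \<open>p\<close> from the binomial coefficient. The last term needs \<open>i + 2 <= i * p\<close>,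
  which for \<open>i = 1\<close> is where \<open>p >= 3\<close> enters.\<close>

lemma one_plus_prime_power:
  fixes v :: int
  assumes p: "prime p" "odd p" and i: "i \<ge> 1"
  shows "int p ^ (i + 2) dvd (1 + int p ^ i * v) ^ p - (1 + int p ^ (i + 1) * v)"
proof -
  have p3: "p \<ge> 3" using p prime_ge_2_nat[of p] by (cases "p = 2") auto
  define y where "y = int p ^ i * v"
  have split: "{..p} = insert 0 (insert 1 {2..p})" using p3 by auto
  have "(1 + y) ^ p = (\<Sum>k\<le>p. of_nat (p choose k) * y ^ k)"
    using binomial_ring[of y 1 p] by (simp add: add.commute)
  also have "\<dots> = 1 + int p * y + (\<Sum>k=2..p. of_nat (p choose k) * y ^ k)"
    unfolding split by (subst sum.insert; simp)+
  finally have "(1 + y) ^ p - (1 + int p ^ (i + 1) * v) = (\<Sum>k=2..p. of_nat (p choose k) * y ^ k)"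
    by (simp add: y_def)
  moreover have "int p ^ (i + 2) dvd of_nat (p choose k) * y ^ k" if k: "k \<in> {2..p}" for k
  proof (cases "k = p")
    case True
    have "1 * 2 \<le> i * (p - 1)" using i p3 by (intro mult_le_mono) auto
    then have "i + 2 \<le> i * p" using p3 by (cases p) auto
    then have "int p ^ (i + 2) dvd (int p ^ i) ^ p" by (metis le_imp_power_dvd power_mult)
    then show ?thesis using True by (simp add: y_def power_mult_distrib)
  next
    case False
    then have "p dvd p choose k" using k p by (intro dvd_choose_prime) auto
    then have "int p dvd int (p choose k)" by simp
    moreover have "i * 2 \<le> i * k" using k by (intro mult_le_mono2) auto
    then have "i + 1 \<le> i * k" using i by linarith
    then have "int p ^ (i + 1) dvd (int p ^ i) ^ k" by (metis le_imp_power_dvd power_mult)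
    then have "int p ^ (i + 1) dvd y ^ k" by (simp add: y_def power_mult_distrib)
    ultimately have "int p * int p ^ (i + 1) dvd of_nat (p choose k) * y ^ k" by (rule mult_dvd_mono)
    then show ?thesis by simp
  qed
  ultimately show ?thesis
    unfolding y_def by (metis (no_types, lifting) dvd_sum)
qed

lemma one_plus_prime_power_iter:
  fixes v :: int
  assumes p: "prime p" "odd p" and i: "i \<ge> 1"
  shows "int p ^ (i + s + 1) dvd (1 + int p ^ i * v) ^ (p ^ s) - (1 + int p ^ (i + s) * v)"
proof (induction s)
  case (Suc s)
  then obtain w where w: "(1 + int p ^ i * v) ^ (p ^ s) - (1 + int p ^ (i + s) * v) = int p ^ (i + s + 1) * w"
    by (elim dvdE)
  \<comment> \<open>The error changes \<open>v\<close> by a multiple of \<open>p\<close> only,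
    invisible at the next precision.\<close>
  define v' where "v' = v + int p * w"
  have "(1 + int p ^ i * v) ^ (p ^ s) = 1 + int p ^ (i + s) * v'"
    using w by (simp add: v'_def algebra_simps)
  then have "(1 + int p ^ i * v) ^ (p ^ Suc s) = (1 + int p ^ (i + s) * v') ^ p"
    by (metis mult.commute power_Suc power_mult)
  moreover have "int p ^ (i + s + 2) dvd (1 + int p ^ (i + s) * v') ^ p - (1 + int p ^ (i + s + 1) * v')"
    using one_plus_prime_power[OF p, of "i + s" v'] i by simp
  moreover have "(1 + int p ^ (i + s + 1) * v') - (1 + int p ^ (i + s + 1) * v) = int p ^ (i + s + 2) * w"
    by (simp add: v'_def algebra_simps)
  then have "int p ^ (i + s + 2) dvd (1 + int p ^ (i + s + 1) * v') - (1 + int p ^ (i + s + 1) * v)"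
    by simp
  ultimately show ?case using dvd_diff_trans[of "int p ^ (i + s + 2)"] by (simp add: add_ac)
qed simp

lemma one_cong_prime_power_iter:
  fixes x :: int
  assumes p: "prime p" "odd p" and i: "i \<ge> 1" and x: "int p ^ i dvd x - 1"
  shows "int p ^ (i + s) dvd x ^ (p ^ s) - 1"
proof -
  obtain v where "x - 1 = int p ^ i * v" using x by (elim dvdE)
  then have v: "x = 1 + int p ^ i * v" by simp
  have "int p ^ (i + s) dvd x ^ (p ^ s) - (1 + int p ^ (i + s) * v)"
    using one_plus_prime_power_iter[OF p i, of s v] power_le_dvd[of "int p" "i + s + 1" _ "i + s"]
    unfolding v by simp
  moreover have "int p ^ (i + s) dvd (1 + int p ^ (i + s) * v) - 1" by simp
  ultimately show ?thesis by (rule dvd_diff_trans)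
qed

lemma power_diff_1_dvd: "x ^ k - 1 dvd x ^ (k * l) - (1 :: 'a :: comm_ring_1)"
  using dvd_diff_power[of "x ^ k - 1" "x ^ k" 1 l] by (simp add: power_mult)

text \<open>Hensel lifting: the \<open>p ^ s\<close>-th power carries a correction at precision
  \<open>1 + l\<close> linearly to precision \<open>s + 1 + l\<close>, so a solution modulo
  \<open>p ^ (s + 1)\<close> can be refined without end.\<close>

lemma prime_power_root_of_inverse:
  fixes m :: int
  assumes p: "prime p" "odd p" and m: "int p ^ (s + 1) dvd m ^ (p - 1) - 1"
  shows "\<exists>a. int p ^ M dvd a ^ (p ^ s) * m - 1"
proof -
  have p3: "p \<ge> 3" using p prime_ge_2_nat[of p] by (cases "p = 2") auto
  have "\<exists>a. int p ^ (s + 1 + l) dvd a ^ (p ^ s) * m - 1" for l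
  proof (induction l)
    case 0
    \<comment> \<open>The starting value is \<open>m ^ (p - 2)\<close>: the total exponent of
      \<open>m\<close> is a multiple of \<open>p - 1\<close>, since \<open>p ^ s\<close> is 1 modulo
      \<open>p - 1\<close>.\<close>
    have "int (p - 1) dvd int (p ^ s) - 1"
      using power_diff_1_dvd[of "int p" 1 s] p3 by (simp add: of_nat_diff)
    then have "int (p - 1) dvd int (p - 1) * int (p ^ s) - (int (p ^ s) - 1)" by simp
    moreover have "int (p - 1) * int (p ^ s) - (int (p ^ s) - 1) = int ((p - 2) * p ^ s + 1)"
      using p3 by (simp add: of_nat_diff algebra_simps)
    ultimately have "p - 1 dvd (p - 2) * p ^ s + 1" by (metis int_dvd_int_iff)
    then obtain l where l: "(p - 2) * p ^ s + 1 = (p - 1) * l" by (elim dvdE)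
    have "(m ^ (p - 2)) ^ (p ^ s) * m = m ^ ((p - 2) * p ^ s + 1)"
      by (simp add: power_mult)
    also have "\<dots> = m ^ ((p - 1) * l)" by (simp only: l)
    finally have "int p ^ (s + 1) dvd (m ^ (p - 2)) ^ (p ^ s) * m - 1"
      using power_diff_1_dvd[of m "p - 1" l] m dvd_trans by metis
    then show ?case by auto
  next
    case (Suc l)
    then obtain a w where w: "a ^ (p ^ s) * m - 1 = int p ^ (s + 1 + l) * w" by (metis dvdE)
    \<comment> \<open>The \<open>p ^ s\<close>-th power of the new factor is
      \<open>1 - p ^ (s + 1 + l) * w\<close> to leading order, which cancels the error.\<close>
    define b where "b = a * (1 + int p ^ (1 + l) * (- w))"
    define k where "k = s + 1 + l"
    have b: "b ^ (p ^ s) * m = (a ^ (p ^ s) * m) * (1 + int p ^ (1 + l) * (- w)) ^ (p ^ s)"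
      unfolding b_def power_mult_distrib by (simp only: mult_ac)
    have am: "a ^ (p ^ s) * m = 1 + int p ^ k * w" using w by (simp add: k_def)
    have "int p ^ (k + 1) dvd (1 + int p ^ (1 + l) * (- w)) ^ (p ^ s) - (1 + int p ^ k * (- w))"
      using one_plus_prime_power_iter[OF p, of "1 + l" s "- w"] by (simp add: k_def add_ac)
    then have "int p ^ (k + 1) dvd (a ^ (p ^ s) * m) *
        ((1 + int p ^ (1 + l) * (- w)) ^ (p ^ s) - (1 + int p ^ k * (- w)))" by (rule dvd_mult)
    then have "int p ^ (k + 1) dvd b ^ (p ^ s) * m - (1 + int p ^ k * w) * (1 + int p ^ k * (- w))"
      unfolding b right_diff_distrib by (simp only: am)
    moreover have "(1 + int p ^ k * w) * (1 + int p ^ k * (- w)) - 1 = int p ^ (k + k) * (- w * w)"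
      by (simp add: algebra_simps power_add)
    moreover have "int p ^ (k + 1) dvd int p ^ (k + k)"
      by (intro le_imp_power_dvd) (simp add: k_def)
    ultimately have "int p ^ (k + 1) dvd b ^ (p ^ s) * m - 1"
      by (metis dvd_diff_trans dvd_mult2)
    then show ?case by (auto simp: k_def)
  qed
  from this[of M] show ?thesis by (meson le_add2 power_le_dvd)
qed

text \<open>The number that is not divisible by the square of \<open>p\<close> is the constant coefficient of \<open>a (x + m)\<^sup>q - 1\<close>
  with \<open>q = p\<^sup>t\<close>, which is therefore Eisenstein up to a unit.\<close>

lemma not_square_dvd_shift:
  fixes m a :: int
  assumes p: "prime p" "odd p" and m: "\<not> int p dvd m"
    and m1: "int p dvd m ^ (p - 1) - 1" and v: "\<not> int p ^ (s + 2) dvd m ^ (p - 1) - 1"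
    and a: "int p ^ (s + 2) dvd a ^ (p ^ s) * m - 1" and st: "s + t > 0"
  shows "\<not> int p ^ 2 dvd a * m ^ (p ^ t) - 1"
proof
  \<comment> \<open>Raising to the power \<open>p ^ s\<close> and comparing with \<open>a\<close>
    makes \<open>m ^ (p ^ (s + t))\<close> congruent to \<open>m\<close> modulo
    \<open>p ^ (s + 2)\<close>, which will contradict \<open>v\<close>.\<close>
  assume "int p ^ 2 dvd a * m ^ (p ^ t) - 1"
  then have "int p ^ (2 + s) dvd (a * m ^ (p ^ t)) ^ (p ^ s) - 1"
    by (intro one_cong_prime_power_iter p) auto
  then have 1: "int p ^ (s + 2) dvd a ^ (p ^ s) * m ^ (p ^ (s + t)) - 1"
    by (simp add: power_mult_distrib power_add mult.commute flip: power_mult)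
  have pp: "prime (int p)" using p by simp
  have p2: "p \<ge> 2" using p prime_ge_2_nat by auto
  have "m ^ (p ^ (s + t)) * (1 - a ^ (p ^ s) * m) + m * (a ^ (p ^ s) * m ^ (p ^ (s + t)) - 1)
      = m ^ (p ^ (s + t)) - m" by (simp add: algebra_simps)
  then have "int p ^ (s + 2) dvd m ^ (p ^ (s + t)) - m"
    using 1 a by (metis dvd_add dvd_diff_commute dvd_mult)
  also have "p ^ (s + t) = 1 + (p ^ (s + t) - 1)" using p2 by simp
  then have "m ^ (p ^ (s + t)) - m = m * (m ^ (p ^ (s + t) - 1) - 1)"
    by (metis (no_types, lifting) mult.right_neutral power_add power_one_right right_diff_distrib)
  finally have 2: "int p ^ (s + 2) dvd m ^ (p ^ (s + t) - 1) - 1"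
    using m pp by (metis coprime_dvd_mult_right_iff coprime_power_left_iff prime_imp_coprime)
  \<comment> \<open>Since \<open>u\<close> and \<open>k\<close> are both 1 modulo \<open>p\<close>,
    the geometric sum relating \<open>u ^ k - 1\<close> to \<open>u - 1\<close> is prime to
    \<open>p\<close>, so the divisibility descends to \<open>u - 1\<close>.\<close>
  define k where "k = (\<Sum>i<s + t. p ^ i)"
  have "int (p ^ (s + t)) - 1 = (int p - 1) * int k"
    using power_diff_1_eq[of "int p" "s + t"] by (simp add: k_def)
  then have "int (p ^ (s + t) - 1) = int ((p - 1) * k)" using p2 by (simp add: of_nat_diff)
  then have k: "p ^ (s + t) - 1 = (p - 1) * k" using of_nat_eq_iff by blast
  define u where "u = m ^ (p - 1)"
  have u: "int p dvd u - 1" using m1 by (simp add: u_def)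
  have "int p dvd (\<Sum>i<k. u ^ i) - (\<Sum>i<k. 1)"
    unfolding sum_subtractf[symmetric] using dvd_diff_power[OF u] by (intro dvd_sum) (metis power_one)
  moreover have "int p dvd int k - 1"
  proof -
    have "k = 1 + (\<Sum>i\<in>{1..<s + t}. p ^ i)"
      unfolding k_def using st by (simp add: lessThan_atLeast0 sum.atLeast_Suc_lessThan)
    moreover have "p dvd (\<Sum>i\<in>{1..<s + t}. p ^ i)" by (intro dvd_sum) auto
    ultimately show ?thesis by (metis add_diff_cancel_left' int_dvd_int_iff of_nat_1 of_nat_add)
  qed
  ultimately have "int p dvd (\<Sum>i<k. u ^ i) - 1"
    using dvd_diff_trans[of "int p" "\<Sum>i<k. u ^ i" "int k" 1] by simp
  then have "\<not> int p dvd (\<Sum>i<k. u ^ i)"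
    using dvd_diff[of "int p" "\<Sum>i<k. u ^ i" "(\<Sum>i<k. u ^ i) - 1"] pp by auto
  then have "coprime (int p ^ (s + 2)) (\<Sum>i<k. u ^ i)"
    using prime_imp_coprime[OF pp] by simp
  moreover have "int p ^ (s + 2) dvd (u - 1) * (\<Sum>i<k. u ^ i)"
    using 2 unfolding k power_mult power_diff_1_eq[of "m ^ (p - 1)" k] u_def .
  ultimately show False using v by (simp add: u_def coprime_dvd_mult_left_iff)
qed

section \<open>Polynomial congruences modulo p and cyclotomic values\<close>

lemma prime_dvd_choose_pred:
  assumes p: "prime p" and i: "i < p"
  shows "int p dvd int ((p - 1) choose i) - (-1) ^ i"
  using i
proof (induction i)
  case (Suc i)
  have "p choose Suc i = ((p - 1) choose i) + ((p - 1) choose Suc i)"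
    using Suc.prems by (cases p) auto
  then have "int ((p - 1) choose Suc i) - (-1) ^ Suc i = int (p choose Suc i) - (int ((p - 1) choose i) - (-1) ^ i)"
    by simp
  moreover have "p dvd p choose Suc i"
    using Suc.prems p by (intro dvd_choose_prime) auto
  then have "int p dvd int (p choose Suc i)" by simp
  ultimately show ?case using Suc by (metis Suc_lessD dvd_diff)
qed simp

text \<open>Row \<open>p - 1\<close> of Pascal's triangle alternates between 1 and -1 modulo
  \<open>p\<close>, and the signs cancel as \<open>p - 1\<close> is even. Comparing coefficients
  avoids cancelling \<open>w - 1\<close>, so zero divisors do no harm.\<close>

lemma geometric_sum_cong_prime:
  fixes w :: "'a :: comm_ring_1"
  assumes p: "prime p" "odd p"
  shows "of_nat p dvd (\<Sum>i<p. w ^ i) - (w - 1) ^ (p - 1)"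
proof -
  have "(w - 1) ^ (p - 1) = (\<Sum>k\<le>p - 1. of_nat ((p - 1) choose k) * w ^ k * (-1) ^ (p - 1 - k))"
    using binomial_ring[of w "-1" "p - 1"] by simp
  also have "{..p - 1} = {..<p}" using prime_gt_0_nat[OF p(1)] by auto
  finally have "(\<Sum>i<p. w ^ i) - (w - 1) ^ (p - 1)
      = (\<Sum>k<p. w ^ k - of_nat ((p - 1) choose k) * w ^ k * (-1) ^ (p - 1 - k))"
    by (simp add: sum_subtractf)
  also have "of_nat p dvd \<dots>"
  proof (rule dvd_sum)
    fix k assume "k \<in> {..<p}"
    then have k: "k < p" by simp
    obtain u where u: "int ((p - 1) choose k) - (-1) ^ k = int p * u"
      using prime_dvd_choose_pred[OF p(1) k] by (elim dvdE)
    have "of_int (int ((p - 1) choose k)) = (of_int ((-1) ^ k + int p * u) :: 'a)"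
      by (rule arg_cong[where f = of_int]) (simp flip: u)
    then have "of_nat ((p - 1) choose k) = ((-1) ^ k + of_nat p * of_int u :: 'a)" by simp
    moreover have "(-1) ^ (p - 1 - k) = ((-1) ^ k :: 'a)"
      using p k by (simp add: minus_one_power_iff)
    moreover have "(-1) ^ k * (-1) ^ k = (1 :: 'a)"
      by (simp flip: power_add)
    ultimately have "w ^ k - of_nat ((p - 1) choose k) * w ^ k * (-1) ^ (p - 1 - k)
        = of_nat p * (- of_int u * w ^ k * (-1) ^ k)"
      by (simp add: algebra_simps)
    then show "of_nat p dvd w ^ k - of_nat ((p - 1) choose k) * w ^ k * (-1) ^ (p - 1 - k)"
      by simp
  qed
  finally show ?thesis .
qed

lemma freshmans_dream_dvd:
  fixes x y :: "'a :: comm_ring_1"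
  assumes p: "prime p"
  shows "of_nat p dvd (x + y) ^ p - (x ^ p + y ^ p)"
proof -
  have p0: "p > 0" using p prime_gt_0_nat by auto
  have split: "{..p} = insert 0 (insert p {1..<p})" using p0 by auto
  have "(x + y) ^ p = (\<Sum>k\<le>p. of_nat (p choose k) * x ^ k * y ^ (p - k))"
    by (rule binomial_ring)
  also have "\<dots> = y ^ p + x ^ p + (\<Sum>k=1..<p. of_nat (p choose k) * x ^ k * y ^ (p - k))"
    unfolding split using p0 by (subst sum.insert; simp)+
  finally have "(x + y) ^ p - (x ^ p + y ^ p) = (\<Sum>k=1..<p. of_nat (p choose k) * x ^ k * y ^ (p - k))"
    by simp
  also have "of_nat p dvd \<dots>"
  proof (rule dvd_sum)
    fix k assume "k \<in> {1..<p}"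
    then have "p dvd p choose k" using p by (intro dvd_choose_prime) auto
    then have "(of_nat p :: 'a) dvd of_nat (p choose k)" by (auto elim!: dvdE)
    then show "of_nat p dvd of_nat (p choose k) * x ^ k * y ^ (p - k)" by (intro dvd_mult2)
  qed
  finally show ?thesis .
qed

lemma freshmans_dream_dvd_iter:
  fixes x y :: "'a :: comm_ring_1"
  assumes p: "prime p"
  shows "of_nat p dvd (x + y) ^ (p ^ k) - (x ^ (p ^ k) + y ^ (p ^ k))"
proof (induction k)
  case (Suc k)
  have eq: "z ^ (p ^ Suc k) = (z ^ (p ^ k)) ^ p" for z :: 'a
    by (simp flip: power_mult add: mult.commute)
  show ?case
    unfolding eq using dvd_diff_power[OF Suc] freshmans_dream_dvd[OF p] by (rule dvd_diff_trans)
qed simp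

text \<open>The cyclotomic polynomial of order \<open>p\<^sup>j\<close>, evaluated at a ring element.\<close>

definition cyclo_ppow :: "nat \<Rightarrow> nat \<Rightarrow> 'a :: comm_ring_1 \<Rightarrow> 'a" where
  "cyclo_ppow p j y = (if j = 0 then y - 1 else (\<Sum>i<p. (y ^ (p ^ (j - 1))) ^ i))"

text \<open>Euler's totient of \<open>p ^ j\<close>.\<close>

definition cyclo_degree :: "nat \<Rightarrow> nat \<Rightarrow> nat" where
  "cyclo_degree p j = (if j = 0 then 1 else p ^ (j - 1) * (p - 1))"

lemma cyclo_degree_pos: "prime p \<Longrightarrow> cyclo_degree p j > 0"
  using prime_gt_1_nat[of p] by (auto simp: cyclo_degree_def)

lemma sum_cyclo_degree:
  assumes "p > 0"
  shows "(\<Sum>j\<le>s. cyclo_degree p j) = p ^ s"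
  using assms by (induction s) (auto simp: cyclo_degree_def algebra_simps diff_mult_distrib2)

lemma poly_cyclo_ppow: "poly (cyclo_ppow p j f) x = cyclo_ppow p j (poly f x)"
  by (simp add: cyclo_ppow_def poly_sum)

text \<open>Modulo \<open>p\<close>, the freshman's dream and \<open>a\<close> identify
  \<open>a * X ^ (p ^ t) - 1\<close> with \<open>a * (X - m) ^ (p ^ t)\<close>, and the cyclotomic
  value at \<open>y\<close> is \<open>(y - 1) ^ cyclo_degree p j\<close>.\<close>

lemma cyclo_ppow_cong:
  fixes a m :: int
  assumes p: "prime p" "odd p" and a: "int p dvd a * m ^ (p ^ t) - 1"
  shows "of_nat p dvd cyclo_ppow p j (monom a (p ^ t))
           - Polynomial.smult (a ^ cyclo_degree p j) ([:- m, 1:] ^ (p ^ t * cyclo_degree p j))"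
proof -
  define Y where "Y = monom a (p ^ t)"
  define L where "L = Polynomial.smult a ([:- m, 1:] ^ (p ^ t))"
  have oddpow: "(- x) ^ (p ^ k) = - (x ^ (p ^ k))" for x :: "int poly" and k
    using p by simp
  have L: "of_nat p dvd (Y - 1) - L"
  proof -
    have "[:- m, 1:] = [:0, 1:] + (- [:m:])" by simp
    then have "of_nat p dvd [:- m, 1:] ^ (p ^ t) - ([:0, 1:] ^ (p ^ t) + (- [:m:]) ^ (p ^ t))"
      using freshmans_dream_dvd_iter[OF p(1)] by metis
    then have "of_nat p dvd [:a:] * ([:- m, 1:] ^ (p ^ t) - ([:0, 1:] ^ (p ^ t) + (- [:m:]) ^ (p ^ t)))"
      by (rule dvd_mult)
    also have "[:a:] * ([:- m, 1:] ^ (p ^ t) - ([:0, 1:] ^ (p ^ t) + (- [:m:]) ^ (p ^ t)))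
        = L - (Y - [:a * m ^ (p ^ t):])"
      unfolding oddpow L_def Y_def
      by (simp add: algebra_simps monom_altdef smult_diff_right smult_add_right poly_const_pow)
    finally have "of_nat p dvd L - (Y - [:a * m ^ (p ^ t):])" .
    moreover have "(of_nat p :: int poly) dvd (Y - [:a * m ^ (p ^ t):]) - (Y - 1)"
    proof -
      obtain u where "a * m ^ (p ^ t) - 1 = int p * u" using a by (elim dvdE)
      then have "1 - a * m ^ (p ^ t) = int p * (- u)" by simp
      moreover have "(Y - [:a * m ^ (p ^ t):]) - (Y - 1) = [:1 - a * m ^ (p ^ t):]"
        by (simp add: one_pCons)
      ultimately have "(Y - [:a * m ^ (p ^ t):]) - (Y - 1) = of_nat p * [:- u:]"
        by (simp add: of_nat_poly)
      then show ?thesis by (metis dvd_triv_left)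
    qed
    ultimately have "of_nat p dvd L - (Y - 1)" by (rule dvd_diff_trans)
    then show ?thesis using dvd_minus_iff[of "of_nat p" "L - (Y - 1)"] by simp
  qed
  have R: "Polynomial.smult (a ^ e) ([:- m, 1:] ^ (p ^ t * e)) = L ^ e" for e
    by (simp add: L_def smult_power power_mult)
  show ?thesis
  proof (cases "j = 0")
    case True
    then show ?thesis using L unfolding R by (simp add: cyclo_ppow_def cyclo_degree_def flip: Y_def)
  next
    case False
    define W where "W = Y ^ (p ^ (j - 1))"
    have "of_nat p dvd (Y + (- 1)) ^ (p ^ (j - 1)) - (W + (- 1) ^ (p ^ (j - 1)))"
      unfolding W_def by (rule freshmans_dream_dvd_iter[OF p(1)])
    then have "of_nat p dvd (Y - 1) ^ (p ^ (j - 1)) - (W - 1)"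
      using p by simp
    then have "of_nat p dvd (W - 1) - (Y - 1) ^ (p ^ (j - 1))"
      using dvd_minus_iff[of "of_nat p" "(Y - 1) ^ (p ^ (j - 1)) - (W - 1)"] by simp
    then have "of_nat p dvd (W - 1) - L ^ (p ^ (j - 1))"
      using dvd_diff_power[OF L] by (rule dvd_diff_trans)
    then have "of_nat p dvd (W - 1) ^ (p - 1) - (L ^ (p ^ (j - 1))) ^ (p - 1)"
      by (rule dvd_diff_power)
    with geometric_sum_cong_prime[OF p]
    have "of_nat p dvd (\<Sum>i<p. W ^ i) - (L ^ (p ^ (j - 1))) ^ (p - 1)"
      by (rule dvd_diff_trans)
    then show ?thesis
      using False unfolding R by (simp add: cyclo_ppow_def cyclo_degree_def W_def power_mult flip: Y_def)
  qed
qed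

text \<open>The value is \<open>p\<close> modulo \<open>p ^ 2\<close>: the powers of
  \<open>w\<close> are linear in the exponent there, and for odd \<open>p\<close> the sum of all
  \<open>i < p\<close> is divisible by \<open>p\<close>.\<close>

lemma cyclo_ppow_not_dvd_square:
  fixes q :: int
  assumes p: "prime p" "odd p" and q: "int p dvd q - 1" and j: "j > 0"
  shows "\<not> int p ^ 2 dvd cyclo_ppow p j q"
proof -
  have p2: "p \<ge> 2" using p prime_ge_2_nat by auto
  define w where "w = q ^ (p ^ (j - 1))"
  have "int p dvd w - 1" using dvd_diff_power[OF q, of "p ^ (j - 1)"] by (simp add: w_def)
  then obtain k where "w - 1 = int p * k" by (elim dvdE)
  then have k: "w = 1 + int p * k" by simp
  have lin: "int p ^ 2 dvd w ^ i - (1 + int i * int p * k)" for i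
  proof (induction i)
    case (Suc i)
    have "w ^ Suc i - (1 + int (Suc i) * int p * k)
        = w * (w ^ i - (1 + int i * int p * k)) + int p ^ 2 * (int i * k * k)"
      unfolding power_Suc k by (simp add: algebra_simps power2_eq_square)
    then show ?case using Suc by (metis dvd_add dvd_mult dvd_triv_left)
  qed simp
  have "int p ^ 2 dvd (\<Sum>i<p. w ^ i - (1 + int i * int p * k))"
    using lin by (intro dvd_sum)
  moreover have "(\<Sum>i<p. w ^ i - (1 + int i * int p * k)) = (\<Sum>i<p. w ^ i) - (int p + int p * k * int (\<Sum>i<p. i))"
    by (simp add: sum_subtractf sum.distrib sum_distrib_left algebra_simps)
  ultimately have 1: "int p ^ 2 dvd cyclo_ppow p j q - (int p + int p * k * int (\<Sum>i<p. i))"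
    using j by (simp add: cyclo_ppow_def w_def)
  have "p dvd (\<Sum>i<p. i)"
  proof -
    have "(\<Sum>i<p. i) = p * ((p - 1) div 2)"
      using p p2 by (simp add: lessThan_atLeast0 Sum_Ico_nat div_mult_swap)
    then show ?thesis by simp
  qed
  then have "int p dvd int (\<Sum>i<p. i)" by (rule of_nat_dvd_iff[THEN iffD2])
  then have "int p * int p dvd (int p * k) * int (\<Sum>i<p. i)" by (intro mult_dvd_mono) auto
  then have "int p ^ 2 dvd (int p + int p * k * int (\<Sum>i<p. i)) - int p" by (simp add: power2_eq_square)
  with 1 have 2: "int p ^ 2 dvd cyclo_ppow p j q - int p" by (rule dvd_diff_trans)
  have "\<not> int p ^ 2 dvd int p"
    using p2 zdvd_imp_le[of "int p ^ 2" "int p"] by (auto simp: power2_eq_square)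
  moreover have "int p ^ 2 dvd int p" if "int p ^ 2 dvd cyclo_ppow p j q"
    using dvd_diff[OF that 2] by simp
  ultimately show ?thesis by blast
qed

text \<open>If \<open>z\<close> has order dividing \<open>p\<^sup>s\<close>, dividing this sum by \<open>p\<close> to the power \<open>s - j\<close> gives the
  idempotent that projects to the part where \<open>z\<close> has order dividing \<open>p\<^sup>j\<close>.\<close>

definition geo_ppow :: "nat \<Rightarrow> nat \<Rightarrow> nat \<Rightarrow> 'a :: comm_ring_1 \<Rightarrow> 'a" where
  "geo_ppow p s j z = (\<Sum>i<p ^ (s - j). (z ^ (p ^ j)) ^ i)"

lemma geo_ppow_mult: "j \<le> s \<Longrightarrow> (z ^ (p ^ j) - 1) * geo_ppow p s j z = z ^ (p ^ s) - 1"
  using power_diff_1_eq[of "z ^ (p ^ j)" "p ^ (s - j)"]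
  by (simp add: geo_ppow_def flip: power_mult power_add)

lemma ppow_sub_one_dvd:
  fixes z :: "'a :: comm_ring_1"
  assumes "j \<le> k"
  shows "z ^ (p ^ j) - 1 dvd (\<Sum>i<l. (z ^ (p ^ k)) ^ i) - of_nat l"
proof -
  have "(\<Sum>i<l. (z ^ (p ^ k)) ^ i) - of_nat l = (\<Sum>i<l. (z ^ (p ^ k)) ^ i - 1)"
    by (simp add: sum_subtractf)
  also have "z ^ (p ^ j) - 1 dvd \<dots>"
  proof (rule dvd_sum)
    fix i
    have "(z ^ (p ^ k)) ^ i = z ^ (p ^ j * (p ^ (k - j) * i))"
      using assms by (simp flip: power_mult power_add mult.assoc)
    then show "z ^ (p ^ j) - 1 dvd (z ^ (p ^ k)) ^ i - 1"
      using power_diff_1_dvd by metis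
  qed
  finally show ?thesis .
qed

text \<open>Modulo \<open>z ^ (p ^ s) - 1\<close>, \<open>z ^ (p ^ j)\<close> acts as 1 on
  \<open>geo_ppow p s j z\<close>, so \<open>geo_ppow p s k z\<close> acts as its number of terms.
  Rescaled, this says that the product of two idempotents is the smaller one.\<close>

lemma geo_ppow_prod:
  fixes z :: "'a :: comm_ring_1"
  assumes "j \<le> k" "k \<le> s"
  shows "z ^ (p ^ s) - 1 dvd geo_ppow p s j z * geo_ppow p s k z - of_nat (p ^ (s - k)) * geo_ppow p s j z"
proof -
  have "(z ^ (p ^ j) - 1) * geo_ppow p s j z dvd (geo_ppow p s k z - of_nat (p ^ (s - k))) * geo_ppow p s j z"
    unfolding geo_ppow_def[of p s k] by (intro mult_dvd_mono ppow_sub_one_dvd assms dvd_refl)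
  then have "z ^ (p ^ s) - 1 dvd (geo_ppow p s k z - of_nat (p ^ (s - k))) * geo_ppow p s j z"
    by (simp only: geo_ppow_mult[OF le_trans[OF assms]])
  then show ?thesis
    by (simp only: left_diff_distrib mult.commute[of "geo_ppow p s j z"])
qed

text \<open>Taking \<open>f\<close> to be the indeterminate over the integers allows
  \<open>W - 1\<close> to be cancelled.\<close>

lemma cyclo_ppow_geo:
  fixes f :: "int poly"
  assumes p: "prime p" and j: "0 < j" "j \<le> s" and f: "f = [:0, 1:]"
  shows "cyclo_ppow p j f * geo_ppow p s j f = geo_ppow p s (j - 1) f"
proof -
  define W where "W = f ^ (p ^ (j - 1))"
  have W: "W ^ p = f ^ (p ^ j)"
    using j by (simp add: W_def flip: power_mult power_Suc2)
  have "(W - 1) * (cyclo_ppow p j f * geo_ppow p s j f) = (W ^ p - 1) * geo_ppow p s j f"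
    using j power_diff_1_eq[of W p] by (simp add: cyclo_ppow_def W_def)
  also have "\<dots> = (W - 1) * geo_ppow p s (j - 1) f"
    unfolding W geo_ppow_mult[OF j(2)] unfolding W_def using j by (subst geo_ppow_mult) auto
  finally have "(W - 1) * (cyclo_ppow p j f * geo_ppow p s j f) = (W - 1) * geo_ppow p s (j - 1) f" .
  moreover have "W \<noteq> 1"
  proof
    assume "W = 1"
    then have "poly W 0 = poly 1 0" by simp
    then show False using prime_gt_0_nat[OF p] by (simp add: W_def f zero_power)
  qed
  ultimately show ?thesis by simp
qed

text \<open>The cyclotomic factor is \<open>p\<close> modulo \<open>f ^ (p ^ (j - 1)) - 1\<close>,
  which \<open>geo_ppow p s (j - 1) f\<close> completes to \<open>f ^ (p ^ s) - 1\<close>. The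
  bracket is the numerator of the idempotent of block \<open>j\<close>.\<close>

lemma cyclo_ppow_annihilates:
  fixes f :: "int poly"
  assumes p: "prime p" and j: "0 < j" "j \<le> s" and f: "f = [:0, 1:]"
  shows "f ^ (p ^ s) - 1 dvd cyclo_ppow p j f * (of_nat p * geo_ppow p s j f - geo_ppow p s (j - 1) f)"
proof -
  have "f ^ (p ^ (j - 1)) - 1 dvd cyclo_ppow p j f - of_nat p"
    using j ppow_sub_one_dvd[of "j - 1" "j - 1" f p p] by (simp add: cyclo_ppow_def)
  then have "(f ^ (p ^ (j - 1)) - 1) * geo_ppow p s (j - 1) f
      dvd (cyclo_ppow p j f - of_nat p) * geo_ppow p s (j - 1) f" by (rule mult_dvd_mono) simp
  then have "f ^ (p ^ s) - 1 dvd (cyclo_ppow p j f - of_nat p) * geo_ppow p s (j - 1) f"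
    using j by (simp add: geo_ppow_mult)
  moreover have "cyclo_ppow p j f * (of_nat p * geo_ppow p s j f) = of_nat p * geo_ppow p s (j - 1) f"
    by (metis cyclo_ppow_geo[OF assms] mult.left_commute)
  then have "cyclo_ppow p j f * (of_nat p * geo_ppow p s j f - geo_ppow p s (j - 1) f)
      = - ((cyclo_ppow p j f - of_nat p) * geo_ppow p s (j - 1) f)"
    by (simp only: right_diff_distrib left_diff_distrib minus_diff_eq)
  ultimately show ?thesis by simp
qed

section \<open>The field generated by a root of a rational integer\<close>

interpretation of_rat_poly_hom: map_poly_idom_hom "of_rat :: rat \<Rightarrow> complex" ..

lemma clear_denominators:
  fixes u :: "rat poly"
  shows "\<exists>d U. d \<noteq> 0 \<and> Polynomial.smult (of_int d) u = map_poly of_int U"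
proof (induction u)
  case 0
  show ?case by (intro exI[of _ 1] exI[of _ 0]) simp
next
  case (pCons a u)
  obtain d U where dU: "d \<noteq> 0" "Polynomial.smult (of_int d) u = map_poly of_int U" using pCons by blast
  obtain x y where xy: "a = Rat.Fract x y" "y > 0" by (cases a) auto
  have "of_int y * a = of_int x" using xy by (simp add: Fract_of_int_quotient)
  then have "Polynomial.smult (of_int (d * y)) (pCons a u) = pCons (of_int (d * x)) (Polynomial.smult (of_int y) (Polynomial.smult (of_int d) u))"
    by (simp add: mult.commute)
  also have "\<dots> = map_poly of_int (pCons (d * x) (Polynomial.smult y U))"
    unfolding dU by (simp add: hom_distribs)
  finally show ?case using dU xy by (intro exI[of _ "d * y"] exI) auto
qed

definition int_span :: "(nat \<Rightarrow> complex) \<Rightarrow> nat \<Rightarrow> complex set" where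
  "int_span v N = {\<Sum>j<N. of_int (c j) * v j | c :: nat \<Rightarrow> int. True}"

lemma int_span_gen: "j < N \<Longrightarrow> v j \<in> int_span v N"
  unfolding int_span_def
  by (intro CollectI exI[of _ "\<lambda>i. if i = j then 1 else 0"]) (simp add: if_distrib[of of_int] if_distrib[of "\<lambda>x. x * _"] cong: if_cong)

lemma int_span_zero: "0 \<in> int_span v N"
  unfolding int_span_def by (intro CollectI exI[of _ "\<lambda>_. 0"]) simp

lemma int_span_add:
  assumes "x \<in> int_span v N" "y \<in> int_span v N"
  shows "x + y \<in> int_span v N"
proof -
  obtain c d where "x = (\<Sum>j<N. of_int (c j) * v j)" "y = (\<Sum>j<N. of_int (d j) * v j)"
    using assms by (auto simp: int_span_def)
  then have "x + y = (\<Sum>j<N. of_int (c j + d j) * v j)" by (simp add: sum.distrib algebra_simps)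
  then show ?thesis unfolding int_span_def by (intro CollectI exI[of _ "\<lambda>j. c j + d j"]) simp
qed

lemma int_span_scale:
  assumes "x \<in> int_span v N"
  shows "of_int k * x \<in> int_span v N"
proof -
  obtain c where "x = (\<Sum>j<N. of_int (c j) * v j)"
    using assms by (auto simp: int_span_def)
  then have "of_int k * x = (\<Sum>j<N. of_int (k * c j) * v j)" by (simp add: sum_distrib_left algebra_simps)
  then show ?thesis unfolding int_span_def by (intro CollectI exI[of _ "\<lambda>j. k * c j"]) simp
qed

lemma int_span_sum: "(\<And>i. i \<in> A \<Longrightarrow> f i \<in> int_span v N) \<Longrightarrow> sum f A \<in> int_span v N"
  by (induction A rule: infinite_finite_induct) (auto intro: int_span_zero int_span_add)

lemma int_span_char_poly:
  assumes "\<And>i. i < N \<Longrightarrow> x * v i \<in> int_span v N" "i0 < N" "v i0 \<noteq> 0"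
  shows "\<exists>f :: int poly. lead_coeff f = 1 \<and> degree f = N \<and> ipoly f x = 0"
  by (rule int_module_char_poly[of N x v]) (use assms in \<open>auto simp: int_span_def\<close>)

lemma subfield_simple_ext: "is_subfield_complex (simple_ext \<alpha>)"
  unfolding simple_ext_def is_subfield_complex_def by auto

lemma gen_in_simple_ext: "\<alpha> \<in> simple_ext \<alpha>"
  unfolding simple_ext_def by auto

locale radical_root =
  fixes n :: nat and m :: int and \<alpha> :: complex
  assumes n_pos: "n > 0"
    and irred: "irreducible (monom (1::rat) n - [:of_int m:])"
    and root: "\<alpha> ^ n = of_int m"
begin

abbreviation "F \<equiv> monom (1::rat) n - [:of_int m:]"

lemma degree_F: "degree F = n"
  using n_pos by (rule degree_monom_diff_const)

lemma eval_F: "poly (map_poly of_rat F) \<alpha> = 0"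
  using root by (simp add: of_rat_poly_hom.hom_minus of_rat_hom.map_poly_hom_monom of_rat_hom.map_poly_pCons_hom poly_monom)

lemma eval_of_int: "poly (map_poly of_rat (map_poly of_int g)) x = ipoly g (x :: complex)"
  by (subst map_poly_map_poly) (auto simp: o_def)

text \<open>\<open>F\<close> is prime over the rationals, so a Bezout identity can be evaluated at
  \<alpha> and cleared of denominators. It yields inverses in the field and the independence of low
  powers of \<alpha>.\<close>

lemma bezout_at_root:
  assumes "\<not> F dvd map_poly of_int g"
  shows "\<exists>U d. d \<noteq> 0 \<and> ipoly U \<alpha> * ipoly g \<alpha> = of_int d"
proof -
  define G :: "rat poly" where "G = map_poly of_int g"
  have "prime_elem F" using irred by (rule irreducible_imp_prime_elem)
  then have "coprime F G" using assms unfolding G_def by (rule prime_elem_imp_coprime)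
  then have "gcd F G = 1" by simp
  then obtain v u where "v * F + u * G = 1"
    using bezout_coefficients_fst_snd[of F G] by metis
  then have "poly (map_poly of_rat (v * F + u * G)) \<alpha> = 1" by simp
  then have 1: "poly (map_poly of_rat u) \<alpha> * ipoly g \<alpha> = 1"
    using eval_F by (simp add: of_rat_poly_hom.hom_add of_rat_poly_hom.hom_mult G_def eval_of_int)
  obtain d U where dU: "d \<noteq> 0" "Polynomial.smult (of_int d) u = map_poly of_int U"
    using clear_denominators by blast
  have "of_int d * poly (map_poly of_rat u) \<alpha> = poly (map_poly of_rat (Polynomial.smult (of_int d) u)) \<alpha>"
    by (simp add: of_rat_hom.map_poly_hom_smult)
  also have "\<dots> = ipoly U \<alpha>" unfolding dU by (rule eval_of_int)
  finally have "ipoly U \<alpha> * ipoly g \<alpha> = of_int d" using 1 by (metis mult.assoc mult.right_neutral)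
  then show ?thesis using dU by blast
qed

lemma F_dvd_imp_zero:
  assumes "F dvd map_poly of_int g"
  shows "ipoly g \<alpha> = 0"
proof -
  obtain h where "map_poly of_int g = F * h" using assms by (elim dvdE)
  then have "ipoly g \<alpha> = poly (map_poly of_rat F) \<alpha> * poly (map_poly of_rat h) \<alpha>"
    by (metis eval_of_int of_rat_poly_hom.hom_mult poly_mult)
  then show ?thesis using eval_F by simp
qed

lemma low_degree_zero:
  assumes "\<forall>i\<ge>n. coeff g i = 0" "ipoly g \<alpha> = 0"
  shows "g = 0"
proof (rule ccontr)
  assume g: "g \<noteq> 0"
  have "degree g < n" using assms(1) g by (metis leI leading_coeff_0_iff)
  have "\<not> F dvd map_poly of_int g"
  proof
    assume "F dvd map_poly of_int g"
    then have "degree F \<le> degree (map_poly of_int g :: rat poly)"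
      using g by (intro dvd_imp_degree_le) auto
    then show False using \<open>degree g < n\<close> degree_F by simp
  qed
  then show False using bezout_at_root assms(2) by fastforce
qed

lemma ipoly_reduce: "\<exists>v. (\<forall>i\<ge>n. coeff v i = 0) \<and> ipoly f \<alpha> = ipoly v \<alpha>"
proof -
  define g where "g = monom 1 n - [:m:]"
  have "degree g = n" "lead_coeff g = 1"
    using degree_monom_diff_const[OF n_pos, of m] by (simp_all add: g_def)
  then obtain u v where uv: "f = g * u + v" "\<forall>i\<ge>n. coeff v i = 0"
    using monic_int_poly_division[of g f] by auto
  have "ipoly g \<alpha> = 0" using root by (simp add: g_def poly_monom)
  then have "ipoly f \<alpha> = ipoly v \<alpha>" by (simp add: uv(1))
  then show ?thesis using uv by blast
qed

lemma ipoly_in_span: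
  assumes "\<And>i. i < n \<Longrightarrow> \<alpha> ^ i * y \<in> int_span v N"
  shows "ipoly f \<alpha> * y \<in> int_span v N"
proof -
  obtain w where w: "\<forall>i\<ge>n. coeff w i = 0" "ipoly f \<alpha> = ipoly w \<alpha>" using ipoly_reduce by blast
  have "ipoly f \<alpha> * y = (\<Sum>i<n. of_int (coeff w i) * (\<alpha> ^ i * y))"
    unfolding w(2) ipoly_eq_sum[OF w(1)] by (simp add: sum_distrib_right mult.assoc)
  also have "\<dots> \<in> int_span v N"
    using assms by (intro int_span_sum int_span_scale) auto
  finally show ?thesis .
qed

text \<open>Multiplication by \<open>x\<close> preserves the module generated by all
  \<open>\<alpha> ^ i\<close> and \<open>\<alpha> ^ i * x\<close> with \<open>i < n\<close>.\<close>

lemma quadratic_algebraic_int: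
  assumes "x * x = x + ipoly g \<alpha>"
  shows "algebraic_int x"
proof -
  define v where "v k = \<alpha> ^ (k mod n) * (if k < n then 1 else x)" for k
  have gen1: "\<alpha> ^ i * 1 \<in> int_span v (2 * n)" if "i < n" for i
    using int_span_gen[of i "2 * n" v] that by (simp add: v_def)
  have genx: "\<alpha> ^ i * x \<in> int_span v (2 * n)" if "i < n" for i
    using int_span_gen[of "n + i" "2 * n" v] that by (simp add: v_def)
  have "\<exists>f :: int poly. lead_coeff f = 1 \<and> degree f = 2 * n \<and> ipoly f x = 0"
  proof (rule int_span_char_poly)
    fix k assume "k < 2 * n"
    show "x * v k \<in> int_span v (2 * n)"
    proof (cases "k < n")
      case True
      then show ?thesis using genx[of k] by (simp add: v_def mult.commute)
    next
      case False
      have "x * v k = \<alpha> ^ (k mod n) * (x * x)" using False by (simp add: v_def)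
      also have "\<dots> = \<alpha> ^ (k mod n) * x + ipoly (monom 1 (k mod n) * g) \<alpha> * 1"
        unfolding assms by (simp add: algebra_simps poly_monom)
      also have "\<dots> \<in> int_span v (2 * n)"
        using n_pos by (intro int_span_add genx ipoly_in_span gen1) auto
      finally show ?thesis .
    qed
  next
    show "0 < 2 * n" using n_pos by simp
    show "v 0 \<noteq> 0" using n_pos by (simp add: v_def)
  qed
  then show ?thesis unfolding algebraic_int_altdef_ipoly by blast
qed

text \<open>The numbers of this form already make up a subfield containing \<alpha>.\<close>

lemma simple_ext_cases:
  assumes "x \<in> simple_ext \<alpha>"
  shows "\<exists>D G. D \<noteq> 0 \<and> of_int D * x = ipoly G \<alpha>"
proof -
  define S where "S = {x. \<exists>D G. D \<noteq> 0 \<and> of_int D * x = ipoly G \<alpha>}"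
  have S_I: "x \<in> S" if "of_int D * x = ipoly G \<alpha>" "D \<noteq> 0" for D x G
    using that by (auto simp: S_def)
  have "is_subfield_complex S"
    unfolding is_subfield_complex_def
  proof (intro conjI ballI impI)
    show "0 \<in> S" unfolding S_def by (intro CollectI exI[of _ 1] exI[of _ 0]) simp
    show "1 \<in> S" unfolding S_def by (intro CollectI exI[of _ 1] exI[of _ 1]) simp
  next
    fix x y assume "x \<in> S" "y \<in> S"
    then obtain D G E H where DG: "D \<noteq> 0" "of_int D * x = ipoly G \<alpha>" "E \<noteq> 0" "of_int E * y = ipoly H \<alpha>"
      unfolding S_def by blast
    have "of_int (D * E) * (x + y) = of_int E * (of_int D * x) + of_int D * (of_int E * y)"
      by (simp add: algebra_simps)
    also have "\<dots> = ipoly (Polynomial.smult E G + Polynomial.smult D H) \<alpha>" unfolding DG by simp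
    finally show "x + y \<in> S" by (rule S_I) (use DG in simp)
    have "of_int (D * E) * (x - y) = of_int E * (of_int D * x) - of_int D * (of_int E * y)"
      by (simp add: algebra_simps)
    also have "\<dots> = ipoly (Polynomial.smult E G - Polynomial.smult D H) \<alpha>" unfolding DG by simp
    finally show "x - y \<in> S" by (rule S_I) (use DG in simp)
    have "of_int (D * E) * (x * y) = (of_int D * x) * (of_int E * y)"
      by (simp add: algebra_simps)
    also have "\<dots> = ipoly (G * H) \<alpha>" unfolding DG by simp
    finally show "x * y \<in> S" by (rule S_I) (use DG in simp)
  next
    fix x assume "x \<in> S" "x \<noteq> 0"
    then obtain D G where DG: "D \<noteq> 0" "of_int D * x = ipoly G \<alpha>" unfolding S_def by blast
    then have "ipoly G \<alpha> \<noteq> 0" using \<open>x \<noteq> 0\<close> by (metis mult_eq_0_iff of_int_eq_0_iff)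
    then obtain U d where U: "d \<noteq> 0" "ipoly U \<alpha> * ipoly G \<alpha> = of_int d"
      using bezout_at_root F_dvd_imp_zero by blast
    have "of_int d * inverse x = ipoly U \<alpha> * (of_int D * x) * inverse x" using U DG by simp
    also have "\<dots> = ipoly (Polynomial.smult D U) \<alpha>" using \<open>x \<noteq> 0\<close> by simp
    finally show "inverse x \<in> S" by (rule S_I) (use U in simp)
  qed
  moreover have "\<alpha> \<in> S" unfolding S_def by (intro CollectI exI[of _ 1] exI[of _ "[:0, 1:]"]) simp
  ultimately have "simple_ext \<alpha> \<subseteq> S" unfolding simple_ext_def by auto
  then show ?thesis using assms by (auto simp: S_def)
qed

text \<open>The characteristic polynomial of \<open>of_int D * x\<close> has degree
  \<open>n\<close>. Substituting \<open>D * X\<close> and dividing by the content keeps it nonzero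
  modulo \<open>p\<close> even if \<open>p\<close> divides \<open>D\<close>, as
  \<open>power_span_mod_prime\<close> requires.\<close>

lemma primitive_annihilator:
  assumes "D \<noteq> 0" "of_int D * x = ipoly G \<alpha>" and p: "prime p"
  shows "\<exists>q k. degree q \<le> n \<and> ipoly q x = 0 \<and> \<not> int p dvd coeff q k"
proof -
  define v where "v k = \<alpha> ^ k" for k
  have gen: "\<alpha> ^ i * 1 \<in> int_span v n" if "i < n" for i
    using int_span_gen[of i n v] that by (simp add: v_def)
  have "\<exists>f :: int poly. lead_coeff f = 1 \<and> degree f = n \<and> ipoly f (ipoly G \<alpha>) = 0"
  proof (rule int_span_char_poly)
    fix k assume "k < n"
    have "ipoly (G * monom 1 k) \<alpha> * 1 \<in> int_span v n" by (intro ipoly_in_span gen)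
    then show "ipoly G \<alpha> * v k \<in> int_span v n" by (simp add: v_def poly_monom)
  next
    show "0 < n" by (fact n_pos)
    show "v 0 \<noteq> 0" by (simp add: v_def)
  qed
  then obtain f where f: "lead_coeff f = 1" "degree f = n" "ipoly f (ipoly G \<alpha>) = 0" by blast
  define q0 where "q0 = pcompose f [:0, D:]"
  have "ipoly q0 x = ipoly f (of_int D * x)"
    by (simp add: q0_def of_int_hom.map_poly_pcompose poly_pcompose mult.commute hom_distribs)
  then have q0: "ipoly q0 x = 0" using f assms by simp
  have nz: "q0 \<noteq> 0" using f assms n_pos by (auto simp: q0_def pcompose_eq_0_iff)
  have "q0 = Polynomial.smult (content q0) (primitive_part q0)" by simp
  then have "ipoly q0 x = of_int (content q0) * ipoly (primitive_part q0) x"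
    by (metis ipoly_simps(8))
  then have "ipoly (primitive_part q0) x = 0" using q0 nz by simp
  moreover have "degree (primitive_part q0) \<le> n" using assms(1) f by (simp add: q0_def degree_pcompose)
  moreover have "\<exists>k. \<not> int p dvd coeff (primitive_part q0) k"
  proof (rule ccontr)
    assume "\<nexists>k. \<not> int p dvd coeff (primitive_part q0) k"
    then have "int p dvd content (primitive_part q0)"
      by (simp add: const_poly_dvd_iff flip: const_poly_dvd_iff_dvd_content)
    then show False using nz p by (simp add: content_primitive_part prime_gt_1_nat)
  qed
  ultimately show ?thesis by blast
qed

text \<open>Modulo a monic annihilator only finitely many powers of \<theta> remain, so one power of
  the denominator of \<theta> serves the whole ring.\<close>

lemma bounded_denominator:
  assumes "algebraic_int \<theta>" "\<theta> \<in> simple_ext \<alpha>"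
  shows "\<exists>D. D \<noteq> 0 \<and> (\<forall>x\<in>int_adjoin \<theta>. \<exists>g. of_int D * x = ipoly g \<alpha>)"
proof -
  obtain h where h: "ipoly h \<theta> = 0" "lead_coeff h = 1"
    using assms(1) unfolding algebraic_int_altdef_ipoly by blast
  obtain D G where DG: "D \<noteq> 0" "of_int D * \<theta> = ipoly G \<alpha>" using simple_ext_cases[OF assms(2)] by blast
  have "\<exists>g. of_int (D ^ degree h) * x = ipoly g \<alpha>" if "x \<in> int_adjoin \<theta>" for x
  proof -
    obtain f where f: "x = ipoly f \<theta>" using \<open>x \<in> int_adjoin \<theta>\<close> by (auto simp: int_adjoin_def)
    obtain u v where uv: "f = h * u + v" "\<forall>i\<ge>degree h. coeff v i = 0"
      using monic_int_poly_division[OF h(2)] by blast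
    have "x = ipoly v \<theta>" by (simp add: f uv(1) h)
    then have "of_int (D ^ degree h) * x = (\<Sum>i<degree h. of_int (D ^ degree h) * (of_int (coeff v i) * \<theta> ^ i))"
      by (simp add: ipoly_eq_sum[OF uv(2)] sum_distrib_left)
    also have "\<dots> = (\<Sum>i<degree h. ipoly (Polynomial.smult (D ^ (degree h - i) * coeff v i) (G ^ i)) \<alpha>)"
    proof (rule sum.cong)
      fix i assume "i \<in> {..<degree h}"
      then have "D ^ degree h = D ^ (degree h - i) * D ^ i" by (simp flip: power_add)
      then have "of_int (D ^ degree h) * (of_int (coeff v i) * \<theta> ^ i)
          = of_int (D ^ (degree h - i) * coeff v i) * (of_int D * \<theta>) ^ i"
        by (simp add: power_mult_distrib)
      then show "of_int (D ^ degree h) * (of_int (coeff v i) * \<theta> ^ i)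
          = ipoly (Polynomial.smult (D ^ (degree h - i) * coeff v i) (G ^ i)) \<alpha>"
        unfolding DG by (simp only: ipoly_simps)
    qed simp
    also have "\<dots> = ipoly (\<Sum>i<degree h. Polynomial.smult (D ^ (degree h - i) * coeff v i) (G ^ i)) \<alpha>"
      by (rule ipoly_sum[symmetric])
    finally show ?thesis by blast
  qed
  then show ?thesis using DG by (intro exI[of _ "D ^ degree h"]) auto
qed

end

section \<open>Blocks of the ring of integers\<close>

lemma ipoly_cyclo_ppow: "ipoly (cyclo_ppow p j f) x = cyclo_ppow p j (ipoly f x)"
  by (simp add: cyclo_ppow_def ipoly_sum)

lemma ipoly_geo_ppow: "ipoly (geo_ppow p s j f) x = geo_ppow p s j (ipoly f x)"
  by (simp add: geo_ppow_def ipoly_sum)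

lemma ipoly_of_nat [simp]: "ipoly (of_nat k) x = of_nat k"
  using ipoly_simps(11)[of "int k" x] by simp

lemma (in complex_subring) rcong_idem_power:
  assumes "rcong q (e * e) e" "e \<in> R"
  shows "rcong q (e * e ^ k) e"
proof (induction k)
  case (Suc k)
  have "rcong q (e * (e * e ^ k)) (e * e)" using assms by (intro rcong_mult_left Suc)
  then show ?case using assms(1) rcong_trans by simp
qed simp

lemma (in complex_subring) ramified_socle:
  assumes p: "prime p" and mem: "e \<in> R" "\<pi> \<in> R" "B \<in> R" "v \<in> R"
    and idem: "rcong (int p) (e * e) e" and e0: "\<not> rcong (int p) e 0"
    and nil: "rcong (int p) (e * \<pi> ^ d) 0" and d: "d > 0"
    and rel: "e * (of_int A * \<pi> ^ d + of_nat p * (of_int k + \<pi> * B)) = of_nat p ^ 2 * v"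
    and k: "\<not> int p dvd k"
  shows "\<not> rcong (int p) (e * \<pi> ^ (d - 1)) 0"
proof
  assume "rcong (int p) (e * \<pi> ^ (d - 1)) 0"
  then obtain w where w: "w \<in> R" "e * \<pi> ^ (d - 1) = of_nat p * w" by (auto simp: rcong_def)
  have pp: "prime (int p)" using p by simp
  have p0: "of_nat p \<noteq> (0 :: complex)" using p by (simp add: prime_gt_0_nat)
  define y where "y = - (of_int A * w + e * B)"
  have y: "y \<in> R" using mem w by (auto simp: y_def)
  have "\<pi> ^ d = \<pi> ^ (d - 1) * \<pi>" using d by (metis Suc_pred' power_Suc2)
  then have "e * \<pi> ^ d = of_nat p * w * \<pi>" using w(2) by (metis mult.assoc)
  moreover have "of_int A * (e * \<pi> ^ d) + of_nat p * (e * (of_int k + \<pi> * B)) = of_nat p ^ 2 * v"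
    using rel by (simp add: algebra_simps)
  ultimately have "of_int A * (of_nat p * w * \<pi>) + of_nat p * (e * (of_int k + \<pi> * B)) = of_nat p ^ 2 * v"
    by simp
  then have "of_nat p * (of_int k * e - \<pi> * y) = of_nat p * (of_nat p * v)"
    by (simp add: y_def algebra_simps power2_eq_square)
  then have "of_int k * e - \<pi> * y = of_nat p * v" using p0 by simp
  then have "rcong (int p) (of_int k * e) (\<pi> * y)" using mem by (auto simp: rcong_def)
  then have "rcong (int p) ((of_int k * e) ^ d) ((\<pi> * y) ^ d)"
    using mem y by (intro rcong_power) auto
  then have "rcong (int p) (e * (of_int k * e) ^ d) (e * (\<pi> * y) ^ d)"
    using mem by (intro rcong_mult_left)
  also have "e * (\<pi> * y) ^ d = y ^ d * (e * \<pi> ^ d)" by (simp add: power_mult_distrib)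
  also have "rcong (int p) \<dots> (y ^ d * 0)" using y by (intro rcong_mult_left nil) auto
  finally have 1: "rcong (int p) (e * (of_int k * e) ^ d) 0" by simp
  have "rcong (int p) (of_int (k ^ d) * e) (of_int (k ^ d) * (e * e ^ d))"
    by (intro rcong_mult_left rcong_sym[OF rcong_idem_power] idem mem) auto
  also have "of_int (k ^ d) * (e * e ^ d) = e * (of_int k * e) ^ d"
    by (simp add: power_mult_distrib)
  also note 1
  finally have "rcong (int p) (of_int (k ^ d) * e) 0" .
  moreover have "coprime (int p) (k ^ d)" using prime_imp_coprime[OF pp k] by simp
  ultimately show False using e0 rcong_cancel mem(1) by blast
qed

text \<open>The precision \<open>e\<close> exceeds the \<open>p\<close>-part of the denominator \<open>D\<close>: this is what keeps the
  idempotents from vanishing modulo \<open>p\<close>. The integer \<open>a\<close>, chosen after \<open>e\<close>, makes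
  \<open>z = a \<alpha>\<^sup>q\<close> with \<open>q = p\<^sup>t\<close> an approximate root of unity of order \<open>p\<^sup>s\<close>.\<close>

locale idempotent_setup = radical_root "p ^ (s + t)" m \<alpha> + complex_subring R
  for p s t :: nat and m :: int and \<alpha> :: complex and R :: "complex set" +
  fixes a D :: int and e :: nat
  assumes p: "prime p" "odd p"
    and R_eq: "R = ring_of_integers (simple_ext \<alpha>)"
    and denom: "\<And>x. x \<in> R \<Longrightarrow> \<exists>g. of_int D * x = ipoly g \<alpha>"
    and denom_bound: "\<not> int p ^ e dvd int p * D"
    and e2: "e \<ge> 2" and fermat: "int p dvd m ^ (p - 1) - 1"
    and a: "int p ^ (2 * s + e) dvd a ^ (p ^ s) * m - 1"
begin

lemma p_pos: "p > 0" and pp: "prime (int p)"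
  using p prime_gt_0_nat by auto

lemma p_nz [simp]: "of_nat p \<noteq> (0 :: complex)" "p \<noteq> 0" using p_pos by auto

definition "z = of_int a * \<alpha> ^ (p ^ t)"

lemma z_ipoly: "z = ipoly (monom a (p ^ t)) \<alpha>" by (simp add: z_def poly_monom)

lemma alpha_mem: "\<alpha> \<in> R"
proof -
  have "poly (map_poly of_int (monom 1 (p ^ (s + t)) - [:m:])) \<alpha> = 0"
    using root by (simp add: poly_monom)
  moreover have "lead_coeff (monom 1 (p ^ (s + t)) - [:m:]) = 1"
    using n_pos by (rule degree_monom_diff_const)
  ultimately show ?thesis
    unfolding R_eq ring_of_integers_def using gen_in_simple_ext algebraic_int_altdef_ipoly by blast
qed

lemma z_mem: "z \<in> R" unfolding z_ipoly using alpha_mem by (rule ipoly_mem)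

lemma z_power: "\<exists>w. z ^ (p ^ s) - 1 = of_nat p ^ (2 * s + e) * of_int w"
proof -
  obtain w where w: "a ^ (p ^ s) * m - 1 = int p ^ (2 * s + e) * w" using a by (elim dvdE)
  have "z ^ (p ^ s) = of_int (a ^ (p ^ s)) * \<alpha> ^ (p ^ (s + t))"
    by (simp add: z_def power_mult_distrib power_add mult.commute flip: power_mult)
  then have "z ^ (p ^ s) - 1 = of_int (a ^ (p ^ s) * m - 1)" by (simp add: root)
  then show ?thesis unfolding w by auto
qed

text \<open>Of the exponent \<open>2 * s + e\<close>, at most \<open>2 * s\<close> pays for the
  denominators of two idempotents; precision \<open>e\<close> is left.\<close>

lemma eval_multiple:
  assumes "[:0, 1:] ^ (p ^ s) - 1 dvd (h :: int poly)"
  shows "\<exists>g. ipoly h z = of_nat p ^ (2 * s + e) * ipoly g \<alpha>"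
proof -
  obtain Q where Q: "h = ([:0, 1:] ^ (p ^ s) - 1) * Q" using assms by (elim dvdE)
  obtain w where w: "z ^ (p ^ s) - 1 = of_nat p ^ (2 * s + e) * of_int w" using z_power by blast
  have "ipoly h z = (z ^ (p ^ s) - 1) * ipoly Q z" by (simp add: Q)
  also have "ipoly Q z = ipoly (pcompose Q (monom a (p ^ t))) \<alpha>"
    unfolding z_ipoly by (simp add: of_int_hom.map_poly_pcompose poly_pcompose)
  finally have "ipoly h z = of_nat p ^ (2 * s + e) * ipoly (Polynomial.smult w (pcompose Q (monom a (p ^ t)))) \<alpha>"
    unfolding w by simp
  then show ?thesis by blast
qed

section \<open>Orthogonal idempotents\<close>

definition "E j = geo_ppow p s j z / of_nat p ^ (s - j)"

lemma E_prod:
  assumes "j \<le> k" "k \<le> s"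
  shows "\<exists>g. E j * E k = E j + of_nat p ^ e * ipoly g \<alpha>"
proof -
  have "[:0, 1:] ^ (p ^ s) - 1 dvd geo_ppow p s j [:0, 1:] * geo_ppow p s k [:0, 1:]
          - of_nat (p ^ (s - k)) * geo_ppow p s j ([:0, 1:] :: int poly)"
    by (rule geo_ppow_prod[OF assms])
  then obtain g where "ipoly (geo_ppow p s j [:0, 1:] * geo_ppow p s k [:0, 1:]
      - of_nat (p ^ (s - k)) * geo_ppow p s j [:0, 1:]) z = of_nat p ^ (2 * s + e) * ipoly g \<alpha>"
    using eval_multiple by blast
  then have g: "geo_ppow p s j z * geo_ppow p s k z = of_nat p ^ (s - k) * geo_ppow p s j z
      + of_nat p ^ (2 * s + e) * ipoly g \<alpha>"
    by (simp only: ipoly_simps ipoly_of_nat ipoly_geo_ppow) (simp add: diff_eq_eq)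
  have "2 * s + e = (s - j) + (s - k) + (j + k + e)" using assms by simp
  then have pw: "of_nat p ^ (2 * s + e) = of_nat p ^ (s - j) * of_nat p ^ (s - k) * (of_nat p ^ (j + k) * of_nat p ^ e :: complex)"
    by (metis power_add)
  have "E j * E k = E j + of_nat p ^ e * (of_nat p ^ (j + k) * ipoly g \<alpha>)"
    unfolding E_def times_divide_times_eq g pw by (simp add: field_simps)
  also have "of_nat p ^ (j + k) * ipoly g \<alpha> = ipoly (Polynomial.smult (int p ^ (j + k)) g) \<alpha>" by simp
  finally show ?thesis by blast
qed

lemma simple_ext_closed:
  shows "x \<in> simple_ext \<alpha> \<Longrightarrow> y \<in> simple_ext \<alpha> \<Longrightarrow> x * y \<in> simple_ext \<alpha>"
    and "x \<in> simple_ext \<alpha> \<Longrightarrow> inverse x \<in> simple_ext \<alpha>"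
proof -
  show "x \<in> simple_ext \<alpha> \<Longrightarrow> y \<in> simple_ext \<alpha> \<Longrightarrow> x * y \<in> simple_ext \<alpha>"
    using subfield_simple_ext unfolding is_subfield_complex_def by blast
  show "x \<in> simple_ext \<alpha> \<Longrightarrow> inverse x \<in> simple_ext \<alpha>"
    using subfield_simple_ext unfolding is_subfield_complex_def by (metis inverse_zero)
qed

text \<open>\<open>E_prod\<close> with \<open>k = j\<close> is a monic quadratic equation for
  \<open>E j\<close> over the ring generated by \<alpha>.\<close>

lemma E_mem:
  assumes "j \<le> s"
  shows "E j \<in> R"
proof -
  obtain g where "E j * E j = E j + of_nat p ^ e * ipoly g \<alpha>" using E_prod[OF order_refl assms] by blast
  then have "E j * E j = E j + ipoly (Polynomial.smult (int p ^ e) g) \<alpha>" by simp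
  then have "algebraic_int (E j)" by (rule quadratic_algebraic_int)
  moreover have "geo_ppow p s j z \<in> R"
    unfolding geo_ppow_def using z_mem by (intro sum_mem power_mem)
  then have "geo_ppow p s j z \<in> simple_ext \<alpha>" by (simp add: R_eq ring_of_integers_def)
  moreover have "of_nat p ^ (s - j) \<in> R" using of_int_mem[of "int p ^ (s - j)"] by simp
  then have "of_nat p ^ (s - j) \<in> simple_ext \<alpha>" by (simp add: R_eq ring_of_integers_def)
  ultimately show ?thesis
    unfolding R_eq ring_of_integers_def E_def divide_inverse by (auto intro!: simple_ext_closed)
qed

lemma E_cong:
  assumes "j \<le> s" "k \<le> s"
  shows "rcong (int p ^ e) (E j * E k) (E (min j k))"
proof -
  have *: "rcong (int p ^ e) (E j * E k) (E j)" if jk: "j \<le> k" "k \<le> s" for j k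
  proof -
    obtain g where "E j * E k = E j + of_nat p ^ e * ipoly g \<alpha>" using E_prod[OF jk] by blast
    then show ?thesis using alpha_mem unfolding rcong_def by (intro bexI[of _ "ipoly g \<alpha>"]) auto
  qed
  show ?thesis
  proof (cases "j \<le> k")
    case True
    then show ?thesis using * assms by (simp add: min_def)
  next
    case False
    then show ?thesis using *[of k j] assms by (simp add: min_def mult.commute)
  qed
qed

text \<open>The \<open>E j\<close> form an increasing chain of idempotents modulo
  \<open>p ^ e\<close>, so successive differences are orthogonal; \<open>eps j\<close> isolates the
  part where \<open>z\<close> has exact order \<open>p ^ j\<close>.\<close>

definition "eps j = E j - (if j = 0 then 0 else E (j - 1))"

lemma eps_mem: "j \<le> s \<Longrightarrow> eps j \<in> R"
  unfolding eps_def using E_mem by auto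

lemma eps_prod_lt:
  assumes "j < k" "k \<le> s"
  shows "rcong (int p ^ e) (eps j * eps k) 0"
proof -
  have k: "rcong (int p ^ e) (E i * eps k) 0" if "i < k" for i
  proof -
    have "min i k = i" "min i (k - 1) = i" "i \<le> s" "k - 1 \<le> s" using assms that by auto
    then have "rcong (int p ^ e) (E i * E k - E i * E (k - 1)) (E i - E i)"
      using E_cong[of i k] E_cong[of i "k - 1"] assms by (intro rcong_diff) metis+
    then show ?thesis using that by (simp add: eps_def algebra_simps)
  qed
  have "rcong (int p ^ e) (E j * eps k - (if j = 0 then 0 else E (j - 1) * eps k)) (0 - 0)"
    using assms by (intro rcong_diff k) (auto intro!: k)
  moreover have "eps j * eps k = E j * eps k - (if j = 0 then 0 else E (j - 1) * eps k)"
    by (simp add: eps_def[of j] left_diff_distrib)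
  ultimately show ?thesis by simp
qed

lemma eps_orth:
  assumes "j \<le> s" "k \<le> s" "j \<noteq> k"
  shows "rcong (int p ^ e) (eps j * eps k) 0"
  using eps_prod_lt[of j k] eps_prod_lt[of k j] assms by (cases "j < k") (auto simp: mult.commute)

lemma eps_idem:
  assumes "j \<le> s"
  shows "rcong (int p ^ e) (eps j * eps j) (eps j)"
proof (cases "j = 0")
  case True
  then show ?thesis using E_cong[of 0 0] by (simp add: eps_def)
next
  case False
  have "min j j = j" "min j (j - 1) = j - 1" "min (j - 1) j = j - 1" "min (j - 1) (j - 1) = j - 1" "j - 1 \<le> s"
    using assms by auto
  then have "rcong (int p ^ e) ((E j * E j - E j * E (j - 1)) - (E (j - 1) * E j - E (j - 1) * E (j - 1)))
      ((E j - E (j - 1)) - (E (j - 1) - E (j - 1)))"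
    using E_cong[of j j] E_cong[of j "j - 1"] E_cong[of "j - 1" j] E_cong[of "j - 1" "j - 1"] assms
    by (intro rcong_diff) metis+
  then show ?thesis using False by (simp add: eps_def algebra_simps)
qed

text \<open>The extra factor \<open>p\<close> brings \<open>E j\<close> and \<open>E (j - 1)\<close>
  over one denominator; it is kept for \<open>j = 0\<close> so that \<open>eps_eq\<close> is
  uniform.\<close>

definition "eps_num j = (if j = 0 then of_nat p * geo_ppow p s 0 (monom a (p ^ t))
   else of_nat p * geo_ppow p s j (monom a (p ^ t)) - geo_ppow p s (j - 1) (monom a (p ^ t)))"

lemma eps_eq:
  assumes "j \<le> s"
  shows "of_nat p ^ (s - j + 1) * eps j = ipoly (eps_num j) \<alpha>"
proof (cases "j = 0")
  case True
  then show ?thesis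
    by (simp only: eps_def eps_num_def E_def ipoly_simps(4,6) ipoly_of_nat ipoly_geo_ppow simp_thms if_True flip: z_ipoly)
      (simp add: field_simps)
next
  case False
  then have "s - (j - 1) = s - j + 1" using assms by simp
  then show ?thesis using False
    by (simp only: eps_def eps_num_def E_def ipoly_simps(4,6) ipoly_of_nat ipoly_geo_ppow if_False flip: z_ipoly)
      (simp add: field_simps)
qed

lemma geo_ppow_monom_coeff:
  assumes "j \<le> s" "i \<ge> p ^ (s + t)"
  shows "coeff (geo_ppow p s j (monom a (p ^ t))) i = 0"
proof -
  have "coeff (((monom a (p ^ t)) ^ (p ^ j)) ^ l) i = 0" if l: "l < p ^ (s - j)" for l
  proof -
    have "p ^ t * p ^ j * l < p ^ t * p ^ j * p ^ (s - j)" using l p_pos by simp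
    also have "\<dots> = p ^ (s + t)" using assms by (simp add: add.commute flip: power_add)
    finally show ?thesis using assms by (simp add: monom_power)
  qed
  then show ?thesis by (simp add: geo_ppow_def coeff_sum)
qed

lemma geo_ppow_monom_coeff_0: "j \<le> s \<Longrightarrow> coeff (geo_ppow p s j (monom a (p ^ t))) 0 = 1"
proof -
  have "coeff (geo_ppow p s j (monom a (p ^ t))) 0 = (\<Sum>i<p ^ (s - j). 0 ^ i)"
    using p_pos by (simp add: geo_ppow_def poly_sum poly_monom zero_power flip: poly_0_coeff_0)
  also have "\<dots> = 1" using p_pos by (simp add: power_0_left)
  finally show ?thesis .
qed

lemma eps_num_coeff:
  assumes "j \<le> s"
  shows "\<forall>i\<ge>p ^ (s + t). coeff (eps_num j) i = 0"
    and "coeff (eps_num j) 0 = (if j = 0 then int p else int p - 1)"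
  using assms geo_ppow_monom_coeff geo_ppow_monom_coeff_0
  by (auto simp: eps_num_def of_nat_poly)

text \<open>Both sides become polynomials in \<alpha> of degree below that of the field, so constant
  coefficients may be compared. That of \<open>eps_num j\<close> is \<open>p\<close> or
  \<open>p - 1\<close>, and \<open>denom_bound\<close> forbids \<open>p ^ e\<close> to divide
  \<open>D\<close> times it.\<close>

lemma eps_nonzero_power:
  assumes "j \<le> s"
  shows "\<not> rcong (int p ^ e) (eps j) 0"
proof
  assume "rcong (int p ^ e) (eps j) 0"
  then obtain x where x: "x \<in> R" "eps j = of_nat p ^ e * x" by (auto simp: rcong_def)
  obtain g where g: "of_int D * x = ipoly g \<alpha>" using denom[OF x(1)] by blast
  obtain v where v: "\<forall>i\<ge>p ^ (s + t). coeff v i = 0" "ipoly g \<alpha> = ipoly v \<alpha>"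
    using ipoly_reduce by blast
  define h where "h = Polynomial.smult D (eps_num j) - Polynomial.smult (int p ^ (s - j + 1 + e)) v"
  have "of_int D * ipoly (eps_num j) \<alpha> = of_nat p ^ (s - j + 1) * of_nat p ^ e * (of_int D * x)"
    unfolding eps_eq[OF assms, symmetric] x(2) by (simp only: mult_ac)
  also have "\<dots> = of_nat p ^ (s - j + 1 + e) * ipoly v \<alpha>" unfolding g v(2) power_add ..
  finally have "ipoly h \<alpha> = 0" by (simp add: h_def)
  moreover have "\<forall>i\<ge>p ^ (s + t). coeff h i = 0" using v(1) eps_num_coeff[OF assms] by (simp add: h_def)
  ultimately have "h = 0" using low_degree_zero by blast
  then have "coeff h 0 = 0" by simp
  then have "D * coeff (eps_num j) 0 = int p ^ e * (int p ^ (s - j + 1) * coeff v 0)"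
    by (simp add: h_def power_add)
  then have dvd: "int p ^ e dvd D * coeff (eps_num j) 0" by simp
  show False
  proof (cases "j = 0")
    case True
    then show False using dvd denom_bound eps_num_coeff[OF assms] by (simp add: mult.commute)
  next
    case False
    have "\<not> int p dvd int p - 1" using dvd_diff[of "int p" "int p" "int p - 1"] pp by auto
    then have "coprime (int p ^ e) (int p - 1)" using prime_imp_coprime[OF pp] by simp
    then have "int p ^ e dvd D"
      using dvd False eps_num_coeff[OF assms] by (simp add: coprime_dvd_mult_left_iff)
    then show False using denom_bound by simp
  qed
qed

lemma rcong_p: "rcong (int p ^ e) x y \<Longrightarrow> rcong (int p) x y"
  using e2 by (elim rcong_modulus_dvd) (auto intro: dvd_power)

text \<open>An idempotent modulo \<open>p\<^sup>e\<close> that vanishes modulo \<open>p\<close> vanishes modulo \<open>p\<^sup>e\<close>, by repeated squaring.\<close>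

lemma eps_nonzero:
  assumes "j \<le> s"
  shows "\<not> rcong (int p) (eps j) 0"
proof
  assume *: "rcong (int p) (eps j) 0"
  have "rcong (int p ^ k) (eps j) 0" if "1 \<le> k" "k \<le> e" for k
    using that
  proof (induction k rule: dec_induct)
    case (step k)
    then obtain w where w: "w \<in> R" "eps j = of_nat p ^ k * w" by (auto simp: rcong_def)
    have "k + k = Suc k + (k - 1)" using step by simp
    then have "of_nat p ^ k * of_nat p ^ k = (of_nat p ^ Suc k * of_nat p ^ (k - 1) :: complex)"
      by (metis power_add)
    then have "eps j * eps j = of_int (int p ^ Suc k) * (of_int (int p ^ (k - 1)) * (w * w))"
      unfolding w(2) by (simp add: algebra_simps)
    moreover have "of_int (int p ^ (k - 1)) * (w * w) \<in> R" using w by (intro mult_mem of_int_mem)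
    ultimately have "rcong (int p ^ Suc k) (eps j * eps j) 0" unfolding rcong_def by auto
    moreover have "rcong (int p ^ Suc k) (eps j * eps j) (eps j)"
      using step by (intro rcong_modulus_dvd[OF eps_idem[OF assms]] le_imp_power_dvd) auto
    ultimately show ?case using rcong_sym rcong_trans by blast
  qed (use * in simp)
  from this[of e] show False using eps_nonzero_power[OF assms] e2 by simp
qed

text \<open>Clearing the denominator of \<open>eps j\<close> costs at most \<open>s\<close> powers
  of \<open>p\<close> for positive \<open>j\<close>, and \<open>E 0\<close> costs exactly
  \<open>s\<close>, so precision \<open>e\<close> survives.\<close>

lemma eps_cyclo:
  assumes "j \<le> s"
  shows "\<exists>v\<in>R. eps j * cyclo_ppow p j z = of_nat p ^ e * v"
proof (cases "j = 0")
  case True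
  obtain w where w: "z ^ (p ^ s) - 1 = of_nat p ^ (2 * s + e) * of_int w" using z_power by blast
  have "eps j * cyclo_ppow p j z = (z ^ (p ^ 0) - 1) * geo_ppow p s 0 z / of_nat p ^ s"
    using True by (simp add: eps_def E_def cyclo_ppow_def)
  also have "\<dots> = of_nat p ^ e * of_int (int p ^ s * w)"
    unfolding geo_ppow_mult[OF le0] w by (simp add: power_add mult_2)
  finally show ?thesis by blast
next
  case False
  have "[:0, 1:] ^ (p ^ s) - 1 dvd cyclo_ppow p j [:0, 1:]
      * (of_nat p * geo_ppow p s j [:0, 1:] - geo_ppow p s (j - 1) ([:0, 1:] :: int poly))"
    using False assms by (intro cyclo_ppow_annihilates p) auto
  then obtain g where "ipoly (cyclo_ppow p j [:0, 1:]
      * (of_nat p * geo_ppow p s j [:0, 1:] - geo_ppow p s (j - 1) [:0, 1:])) z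
      = of_nat p ^ (2 * s + e) * ipoly g \<alpha>"
    using eval_multiple by blast
  then have g: "cyclo_ppow p j z * (of_nat p * geo_ppow p s j z - geo_ppow p s (j - 1) z)
      = of_nat p ^ (2 * s + e) * ipoly g \<alpha>"
    by (simp only: ipoly_simps ipoly_of_nat ipoly_geo_ppow ipoly_cyclo_ppow) simp
  have "of_nat p * geo_ppow p s j z - geo_ppow p s (j - 1) z = of_nat p ^ (s - j + 1) * eps j"
    unfolding eps_eq[OF assms] using False
    by (simp only: eps_num_def ipoly_simps(4,6) ipoly_of_nat ipoly_geo_ppow if_False flip: z_ipoly)
  with g have "of_nat p ^ (s - j + 1) * (eps j * cyclo_ppow p j z) = of_nat p ^ (2 * s + e) * ipoly g \<alpha>"
    by (simp only: mult_ac)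
  also have "2 * s + e = (s - j + 1) + (e + (s + j - 1))" using False assms by simp
  finally have "of_nat p ^ (s - j + 1) * (eps j * cyclo_ppow p j z)
      = of_nat p ^ (s - j + 1) * (of_nat p ^ e * (of_int (int p ^ (s + j - 1)) * ipoly g \<alpha>))"
    by (simp add: power_add algebra_simps)
  then have "eps j * cyclo_ppow p j z = of_nat p ^ e * (of_int (int p ^ (s + j - 1)) * ipoly g \<alpha>)"
    by (simp only: mult_cancel_left power_eq_0_iff p_nz simp_thms)
  then show ?thesis by (rule bexI) (intro mult_mem of_int_mem ipoly_mem alpha_mem)
qed

section \<open>Total ramification of the blocks\<close>

definition "bdeg j = p ^ t * cyclo_degree p j"

lemma bdeg_pos: "bdeg j > 0" using p_pos cyclo_degree_pos[OF p(1), of j] by (simp add: bdeg_def)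

lemma sum_bdeg: "(\<Sum>j\<le>s. bdeg j) = p ^ (s + t)"
  using sum_cyclo_degree[OF p_pos, of s] by (simp add: bdeg_def power_add flip: sum_distrib_left)

lemma m_ppow: "int p dvd m ^ (p ^ k) - m"
proof (induction k)
  case (Suc k)
  have "m * (m ^ (p - 1) - 1) = m ^ p - m"
    using p_pos by (simp add: right_diff_distrib flip: power_Suc)
  then have "int p dvd m ^ p - m" using fermat by (metis dvd_mult)
  with dvd_diff_power[OF Suc, of p] have "int p dvd (m ^ (p ^ k)) ^ p - m" by (rule dvd_diff_trans)
  then show ?case by (simp add: mult.commute flip: power_mult)
qed simp

text \<open>For \<open>x = a * m ^ (p ^ t)\<close>, modulo \<open>p\<close> the power
  \<open>(x - 1) ^ (p ^ s)\<close> is \<open>x ^ (p ^ s) - 1\<close>, hence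
  \<open>a ^ (p ^ s) * m - 1\<close>, which is 0.\<close>

lemma a_cong: "int p dvd a * m ^ (p ^ t) - 1"
proof -
  define x where "x = a * m ^ (p ^ t)"
  have "of_nat p dvd (x + (- 1)) ^ (p ^ s) - (x ^ (p ^ s) + (- 1) ^ (p ^ s))"
    by (rule freshmans_dream_dvd_iter[OF p(1)])
  then have 1: "int p dvd (x - 1) ^ (p ^ s) - (x ^ (p ^ s) - 1)" using p by simp
  have "int p dvd int p ^ (2 * s + e)" using e2 by (intro dvd_power) auto
  then have am: "int p dvd a ^ (p ^ s) * m - 1" using a dvd_trans by blast
  have "x ^ (p ^ s) = a ^ (p ^ s) * m ^ (p ^ (s + t))"
    by (simp add: x_def power_mult_distrib power_add mult.commute flip: power_mult)
  then have "x ^ (p ^ s) - a ^ (p ^ s) * m = a ^ (p ^ s) * (m ^ (p ^ (s + t)) - m)"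
    by (simp add: right_diff_distrib)
  then have "int p dvd x ^ (p ^ s) - a ^ (p ^ s) * m" using m_ppow by simp
  then have "int p dvd x ^ (p ^ s) - 1" using am by (rule dvd_diff_trans)
  from dvd_add[OF 1 this] have "int p dvd (x - 1) ^ (p ^ s)" by simp
  then show ?thesis using pp prime_dvd_power unfolding x_def by blast
qed

lemma block_relation:
  "\<exists>A G. \<not> int p dvd A \<and> cyclo_ppow p j (monom a (p ^ t)) = Polynomial.smult A ([:- m, 1:] ^ bdeg j) + of_nat p * G"
proof -
  have pow: "int p dvd int p ^ (2 * s + e)" using e2 by (intro dvd_power) auto
  have "\<not> int p dvd a"
  proof
    assume "int p dvd a"
    then have "int p dvd a ^ (p ^ s) * m" 
      using dvd_trans[OF _ dvd_power[of "p ^ s" a]] p_pos by (intro dvd_mult2) simp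
    moreover have "int p dvd a ^ (p ^ s) * m - 1" using a pow dvd_trans by blast
    ultimately have "int p dvd a ^ (p ^ s) * m - (a ^ (p ^ s) * m - 1)" by (rule dvd_diff)
    then show False using pp by simp
  qed
  then have "\<not> int p dvd a ^ cyclo_degree p j" using pp prime_dvd_power by blast
  moreover obtain G where "cyclo_ppow p j (monom a (p ^ t)) - Polynomial.smult (a ^ cyclo_degree p j) ([:- m, 1:] ^ bdeg j) = of_nat p * G"
    using cyclo_ppow_cong[OF p a_cong, of j] unfolding bdeg_def by (elim dvdE)
  then have "cyclo_ppow p j (monom a (p ^ t)) = Polynomial.smult (a ^ cyclo_degree p j) ([:- m, 1:] ^ bdeg j) + of_nat p * G"
    by (simp add: algebra_simps)
  ultimately show ?thesis by blast
qed

text \<open>\<open>eps j\<close> kills the cyclotomic value modulo \<open>p ^ 2\<close>. Read modulo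
  \<open>p\<close>, this bounds the nilpotency of \<open>\<pi>\<close>; read modulo
  \<open>p ^ 2\<close>, it is the Eisenstein relation for \<open>ramified_socle\<close>.\<close>

lemma block_nil_socle:
  assumes j: "j \<le> s" and sq: "t = 0 \<or> \<not> int p ^ 2 dvd a * m ^ (p ^ t) - 1"
  shows "rcong (int p) (eps j * (\<alpha> - of_int m) ^ bdeg j) 0"
    and "\<not> rcong (int p) (eps j * (\<alpha> - of_int m) ^ (bdeg j - 1)) 0"
proof -
  define \<pi> where "\<pi> = \<alpha> - of_int m"
  have \<pi>: "\<pi> \<in> R" using alpha_mem by (auto simp: \<pi>_def)
  obtain A G where A: "\<not> int p dvd A"
    and G: "cyclo_ppow p j (monom a (p ^ t)) = Polynomial.smult A ([:- m, 1:] ^ bdeg j) + of_nat p * G"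
    using block_relation by blast
  obtain v where v: "v \<in> R" "eps j * cyclo_ppow p j z = of_nat p ^ e * v" using eps_cyclo[OF j] by blast
  have "ipoly (cyclo_ppow p j (monom a (p ^ t))) \<alpha> = of_int A * \<pi> ^ bdeg j + of_nat p * ipoly G \<alpha>"
    unfolding G \<pi>_def by (simp add: algebra_simps)
  then have cz: "cyclo_ppow p j z = of_int A * \<pi> ^ bdeg j + of_nat p * ipoly G \<alpha>"
    unfolding ipoly_cyclo_ppow z_ipoly .
  obtain B where B: "G = [:poly G m:] + [:- m, 1:] * B"
  proof -
    have "[:- m, 1:] dvd G - [:poly G m:]" by (simp flip: poly_eq_0_iff_dvd)
    then obtain B where "G - [:poly G m:] = [:- m, 1:] * B" by (elim dvdE)
    then show ?thesis using that by (metis diff_eq_eq add.commute)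
  qed
  have G\<alpha>: "ipoly G \<alpha> = of_int (poly G m) + \<pi> * ipoly B \<alpha>"
    by (subst B) (simp add: \<pi>_def algebra_simps)
  define u where "u = of_int (int p ^ (e - 2)) * v"
  have u: "u \<in> R" unfolding u_def using v(1) by (intro mult_mem of_int_mem)
  have "of_nat p ^ e = (of_nat p ^ 2 * of_nat p ^ (e - 2) :: complex)" 
    using e2 by (metis le_add_diff_inverse power_add)
  then have rel: "eps j * (of_int A * \<pi> ^ bdeg j + of_nat p * (of_int (poly G m) + \<pi> * ipoly B \<alpha>)) = of_nat p ^ 2 * u"
    using v(2) unfolding cz G\<alpha> u_def by simp
  have "of_int A * (eps j * \<pi> ^ bdeg j) = of_int (int p) * (of_nat p * u - eps j * (of_int (poly G m) + \<pi> * ipoly B \<alpha>))"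
    using rel by (simp add: algebra_simps power2_eq_square)
  moreover have "of_int (int p) * u - eps j * (of_int (poly G m) + \<pi> * ipoly B \<alpha>) \<in> R"
    using u \<pi> eps_mem[OF j] alpha_mem by (intro diff_mem mult_mem add_mem ipoly_mem of_int_mem)
  ultimately have "rcong (int p) (of_int A * (eps j * \<pi> ^ bdeg j)) 0" unfolding rcong_def by auto
  then have nil: "rcong (int p) (eps j * \<pi> ^ bdeg j) 0"
    using rcong_cancel[of "int p" A] prime_imp_coprime[OF pp A] eps_mem[OF j] \<pi> by blast
  then show "rcong (int p) (eps j * (\<alpha> - of_int m) ^ bdeg j) 0" by (simp add: \<pi>_def)
  have "\<not> rcong (int p) (eps j * \<pi> ^ (bdeg j - 1)) 0"
  \<comment> \<open>Here the block has dimension 1 and its socle element is \<open>eps j\<close>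
    itself.\<close>
  proof (cases "j = 0 \<and> t = 0")
    case True
    then have "bdeg j = 1" unfolding bdeg_def cyclo_degree_def by simp
    then show ?thesis using eps_nonzero[OF j]
      by (simp only: diff_self_eq_0 power_0 mult_1_right not_False_eq_True)
  next
    case False
    \<comment> \<open>Evaluation at \<open>m\<close> kills the power of \<open>X - m\<close> and
      isolates the Eisenstein constant term.\<close>
    have "poly (cyclo_ppow p j (monom a (p ^ t))) m = int p * poly G m"
      unfolding G using bdeg_pos[of j] by (simp add: zero_power)
    then have "cyclo_ppow p j (a * m ^ (p ^ t)) = int p * poly G m"
      by (simp add: poly_cyclo_ppow poly_monom)
    moreover have "\<not> int p ^ 2 dvd cyclo_ppow p j (a * m ^ (p ^ t))"
    proof (cases "j = 0")
      case True
      then show ?thesis using sq False by (simp add: cyclo_ppow_def)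
    next
      case False
      then show ?thesis by (intro cyclo_ppow_not_dvd_square p a_cong) auto
    qed
    ultimately have "\<not> int p dvd poly G m" by (simp add: power2_eq_square)
    then show ?thesis
      by (rule ramified_socle[OF p(1) eps_mem[OF j] \<pi> ipoly_mem[OF alpha_mem] u
            rcong_p[OF eps_idem[OF j]] eps_nonzero[OF j] nil bdeg_pos rel])
  qed
  then show "\<not> rcong (int p) (eps j * (\<alpha> - of_int m) ^ (bdeg j - 1)) 0" by (simp add: \<pi>_def)
qed

end

theorem theorem2p3:
  fixes p r :: nat and m :: int and \<alpha> :: complex
  assumes "prime p" and "odd p" and "r > 0"
    and "m \<noteq> 1" and "squarefree m" and "\<not> int p dvd m"
    and "irreducible (monom (1::rat) (p ^ r) - [:of_int m:])"
    and "\<alpha> ^ (p ^ r) = of_int m"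
    and "multiplicity (int p) (m ^ (p - 1) - 1) > p"
    and "r \<ge> p"
  shows "\<not> monogenic (simple_ext \<alpha>)"
proof
  assume "monogenic (simple_ext \<alpha>)"
  then obtain \<theta> where \<theta>: "\<theta> \<in> ring_of_integers (simple_ext \<alpha>)"
    and R: "ring_of_integers (simple_ext \<alpha>) = int_adjoin \<theta>"
    by (auto simp: monogenic_def)
  define \<nu> where "\<nu> = multiplicity (int p) (m ^ (p - 1) - 1)"
  \<comment> \<open>A \<open>p ^ s\<close>-th root of the inverse of \<open>m\<close> needs
    \<open>s + 1 <= \<nu>\<close>, and forming \<open>z\<close> from a power of \<alpha> needs
    \<open>s <= r\<close>.\<close>
  define s where "s = min (\<nu> - 1) r"
  define t where "t = r - s"
  have pp: "prime (int p)" using assms(1) by simp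
  have st: "s + t = r" and ps: "p \<le> s" and s\<nu>: "s + 1 \<le> \<nu>"
    using assms(9,10) by (auto simp: s_def t_def \<nu>_def)
  \<comment> \<open>\<open>multiplicity\<close> is 0 at 0, so a positive bound excludes that
    value.\<close>
  have m1: "m ^ (p - 1) - 1 \<noteq> 0" using assms(9) by (metis multiplicity_zero not_less_zero)
  have dvd: "int p ^ (s + 1) dvd m ^ (p - 1) - 1"
    using s\<nu> by (simp only: \<nu>_def multiplicity_dvd')
  \<comment> \<open>If \<open>t > 0\<close>, the minimum is \<open>\<nu> - 1\<close>, so the
    divisibility in \<open>dvd\<close> is sharp.\<close>
  have ndvd: "\<not> int p ^ (s + 2) dvd m ^ (p - 1) - 1" if "t > 0"
  proof
    assume "int p ^ (s + 2) dvd m ^ (p - 1) - 1"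
    then have "s + 2 \<le> \<nu>" unfolding \<nu>_def using m1 pp by (intro multiplicity_geI) auto
    moreover have "s = \<nu> - 1" using that by (auto simp: t_def s_def)
    ultimately show False by simp
  qed
  have fermat: "int p dvd m ^ (p - 1) - 1"
    using dvd by (rule dvd_trans[rotated]) (simp add: dvd_power)
  interpret rad: radical_root "p ^ (s + t)" m \<alpha>
    using assms by unfold_locales (auto simp: st prime_gt_0_nat)
  have \<theta>K: "algebraic_int \<theta>" "\<theta> \<in> simple_ext \<alpha>" using \<theta> by (auto simp: ring_of_integers_def)
  obtain D where D: "D \<noteq> 0" "\<And>x. x \<in> int_adjoin \<theta> \<Longrightarrow> \<exists>g. of_int D * x = ipoly g \<alpha>"
    using rad.bounded_denominator[OF \<theta>K] by blast
  \<comment> \<open>Adding 2 both exceeds the \<open>p\<close>-part of \<open>p * D\<close> and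
    ensures \<open>e >= 2\<close>.\<close>
  define e where "e = multiplicity (int p) (int p * D) + 2"
  have De: "\<not> int p ^ e dvd int p * D"
  proof
    assume "int p ^ e dvd int p * D"
    then have "e \<le> multiplicity (int p) (int p * D)" using D pp by (intro multiplicity_geI) auto
    then show False by (simp add: e_def)
  qed
  obtain a where a: "int p ^ (2 * s + e) dvd a ^ (p ^ s) * m - 1"
    using prime_power_root_of_inverse[OF assms(1,2) dvd] by blast
  interpret idempotent_setup p s t m \<alpha> "int_adjoin \<theta>" a D e
  proof unfold_locales
    fix k :: int and x y
    show "of_int k \<in> int_adjoin \<theta>" unfolding int_adjoin_def
      by (intro CollectI exI[of _ "[:k:]"]) simp
    assume "x \<in> int_adjoin \<theta>" "y \<in> int_adjoin \<theta>"
    then obtain f g where fg: "x = ipoly f \<theta>" "y = ipoly g \<theta>" by (auto simp: int_adjoin_def)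
    have "x + y = ipoly (f + g) \<theta>" "x * y = ipoly (f * g) \<theta>" by (simp_all add: fg)
    then show "x + y \<in> int_adjoin \<theta>" "x * y \<in> int_adjoin \<theta>" unfolding int_adjoin_def by blast+
  qed (use assms D De a R fermat in \<open>auto simp: e_def\<close>)
  obtain E G where EG: "E \<noteq> 0" "of_int E * \<theta> = ipoly G \<alpha>" using rad.simple_ext_cases[OF \<theta>K(2)] by blast
  obtain q k where q: "degree q \<le> p ^ (s + t)" "ipoly q \<theta> = 0" "\<not> int p dvd coeff q k"
    using rad.primitive_annihilator[OF EG assms(1)] by blast
  have sq: "t = 0 \<or> \<not> int p ^ 2 dvd a * m ^ (p ^ t) - 1"
  proof (cases "t = 0")
    case False
    have "int p ^ (s + 2) dvd a ^ (p ^ s) * m - 1"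
      using a by (rule dvd_trans[rotated]) (simp add: le_imp_power_dvd e_def)
    then show ?thesis
      using not_square_dvd_shift[OF assms(1,2,6) fermat ndvd] False by simp
  qed simp
  have "s < p"
    by (rule idempotent_blocks_bound[OF refl assms(1) q sum_bdeg bdeg_pos eps_mem _
          rcong_p[OF eps_idem] rcong_p[OF eps_orth] block_nil_socle(1)[OF _ sq] block_nil_socle(2)[OF _ sq]])
      (use alpha_mem in auto)
  then show False using ps by simp
qed

end
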